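(* In the setting of the context, the least squares estimator of the serial correlation parameter satisfies $$\lim_{n\to\infty}\widehat{\rho}_n=\rho^{*}\quad\text{almost surely},$$ where $\rho^{*}=\theta_p\,\rho\,\theta_p^{*}$ and $\theta_p^{*}$ is the $p$-th component of $\theta^{*}=\alpha(I_p-\theta_p\rho J_p)\beta$.
   Context: Let $p\ge 1$ be an integer, $\theta=(\theta_1,\dots,\theta_p)'\in\mathbb{R}^p$ a nonzero vector with $\|\theta\|_1=\sum_i|\theta_i|<1$ and $\rho\in\mathbb{R}$ with $|\rho|<1$. A prime denotes transposition. The process is given, for all $n\ge1$, by $$X_n=\theta_1X_{n-1}+\cdots+\theta_pX_{n-p}+\varepsilon_n,\qquad \varepsilon_n=\rho\,\varepsilon_{n-1}+V_n,$$ with square-integrable initial value $X_0=\varepsilon_0$ and $X_{-1}=\cdots=X_{-p}=0$, where $(V_n)$ is a sequence of square-integrable, independent and identically distributed random variables with zero mean and variance $\sigma^2>0$. Let $\Phi_n^p=(X_n,X_{n-1},\dots,X_{n-p+1})'$ and $S_n=\sum_{k=0}^n\Phi_k^p(\Phi_k^p)'+S$, where $S$ is a fixed symmetric positive definite $p\times p$ matrix. The least squares estimator of $\theta$ is $\widehat{\theta}_n=(S_{n-1})^{-1}\sum_{k=1}^n\Phi_{k-1}^pX_k$, $n\ge1$. At stage $n$ the residuals are $\widehat{\varepsilon}_0=X_0$ and $\widehat{\varepsilon}_k=X_k-\widehat{\theta}_n'\Phi_{k-1}^p$ for $1\le k\le n$ (they depend on $n$), and $$\widehat{\rho}_n=\Bigl(\sum_{k=1}^n\widehat{\varepsilon}_{k-1}^{\,2}\Bigr)^{-1}\sum_{k=1}^n\widehat{\varepsilon}_k\,\widehat{\varepsilon}_{k-1}.$$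 $I_p$ is the identity matrix and $J_p$ the exchange matrix of order $p$ (ones on the antidiagonal, zeros elsewhere), and $$\alpha=\frac{1}{(1-\theta_p\rho)(1+\theta_p\rho)},\qquad \beta=(\theta_1+\rho,\ \theta_2-\theta_1\rho,\ \dots,\ \theta_p-\theta_{p-1}\rho)'.$$ *)

theory Defs
  imports
    "HOL-Probability.Probability"
    "Jordan_Normal_Form.Gauss_Jordan_Elimination"
begin

hide_const (open) Finite_Cartesian_Product.vec Finite_Cartesian_Product.mat
  Finite_Cartesian_Product.transpose
unbundle no vec_syntax and no inner_syntax

text \<open>
  Vectors and matrices over the dimension \<open>p\<close> are those of \<open>Jordan_Normal_Form\<close>, indexed from 0:
  the component \<open>\<theta>\<^sub>i\<close> is \<open>\<theta> $ (i - 1)\<close>, and \<open>\<theta>\<^sub>p\<close> is \<open>\<theta> $ (p - 1)\<close>.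
  The estimators are defined for one trajectory \<open>x :: int \<Rightarrow> real\<close>, where \<open>x k\<close> stands for \<open>X\<^sub>k(\<omega>)\<close>;
  integer times accommodate the initial values at \<open>-1, \<dots>, -p\<close>.
\<close>

definition pos_def_mat :: "nat \<Rightarrow> real mat \<Rightarrow> bool" where
  "pos_def_mat p S \<longleftrightarrow> S \<in> carrier_mat p p \<and> transpose_mat S = S \<and>
     (\<forall>v \<in> carrier_vec p. v \<noteq> 0\<^sub>v p \<longrightarrow> v \<bullet> (S *\<^sub>v v) > 0)"

definition regressor :: "nat \<Rightarrow> (int \<Rightarrow> real) \<Rightarrow> nat \<Rightarrow> real vec" where
  "regressor p x n = vec p (\<lambda>i. x (int n - int i))"

text \<open>\<open>\<Sum>\<^sub>k \<Phi>\<^sub>k \<Phi>\<^sub>k' + S\<close>, with the sum of rank-one matrices written out entrywise.\<close>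

definition gram :: "nat \<Rightarrow> real mat \<Rightarrow> (int \<Rightarrow> real) \<Rightarrow> nat \<Rightarrow> real mat" where
  "gram p S x n =
     mat p p (\<lambda>(i, j). \<Sum>k = 0..n. regressor p x k $ i * regressor p x k $ j) + S"

text \<open>
  For \<open>S\<close> positive definite the matrix \<open>gram p S x n\<close> is invertible, so \<open>mat_inverse\<close> never
  returns \<open>None\<close> here.
\<close>

definition theta_hat :: "nat \<Rightarrow> real mat \<Rightarrow> (int \<Rightarrow> real) \<Rightarrow> nat \<Rightarrow> real vec" where
  "theta_hat p S x n =
     the (mat_inverse (gram p S x (n - 1))) *\<^sub>v
     finsum_vec TYPE(real) p (\<lambda>k. x (int k) \<cdot>\<^sub>v regressor p x (k - 1)) {1..n}"

definition residual :: "nat \<Rightarrow> real mat \<Rightarrow> (int \<Rightarrow> real) \<Rightarrow> nat \<Rightarrow> nat \<Rightarrow> real" where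
  "residual p S x n k =
     (if k = 0 then x 0 else x (int k) - theta_hat p S x n \<bullet> regressor p x (k - 1))"

definition rho_hat :: "nat \<Rightarrow> real mat \<Rightarrow> (int \<Rightarrow> real) \<Rightarrow> nat \<Rightarrow> real" where
  "rho_hat p S x n =
     inverse (\<Sum>k = 1..n. (residual p S x n (k - 1))\<^sup>2) *
     (\<Sum>k = 1..n. residual p S x n k * residual p S x n (k - 1))"

definition exchange_mat :: "nat \<Rightarrow> real mat" where
  "exchange_mat p = mat p p (\<lambda>(i, j). if i + j + 1 = p then 1 else 0)"

definition alpha :: "nat \<Rightarrow> real vec \<Rightarrow> real \<Rightarrow> real" where
  "alpha p \<theta> \<rho> = 1 / ((1 - \<theta> $ (p - 1) * \<rho>) * (1 + \<theta> $ (p - 1) * \<rho>))"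

definition beta :: "nat \<Rightarrow> real vec \<Rightarrow> real \<Rightarrow> real vec" where
  "beta p \<theta> \<rho> = vec p (\<lambda>i. if i = 0 then \<theta> $ 0 + \<rho> else \<theta> $ i - \<theta> $ (i - 1) * \<rho>)"

definition theta_star :: "nat \<Rightarrow> real vec \<Rightarrow> real \<Rightarrow> real vec" where
  "theta_star p \<theta> \<rho> =
     alpha p \<theta> \<rho> \<cdot>\<^sub>v ((1\<^sub>m p - (\<theta> $ (p - 1) * \<rho>) \<cdot>\<^sub>m exchange_mat p) *\<^sub>v beta p \<theta> \<rho>)"

definition rho_star :: "nat \<Rightarrow> real vec \<Rightarrow> real \<Rightarrow> real" where
  "rho_star p \<theta> \<rho> = \<theta> $ (p - 1) * \<rho> * theta_star p \<theta> \<rho> $ (p - 1)"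

end

theory Submission
  imports Defs "Jordan_Normal_Form.Determinant"
begin

text \<open>
  With the lag operator \<open>L\<close> the model is \<open>(1 - \<Sum>\<^sub>i \<theta>\<^sub>i L\<^sup>i) X = \<epsilon>\<close>, \<open>(1 - \<rho>L) \<epsilon> = V\<close>, so \<open>X\<close>
  is the output of a linear filter applied to white noise: \<open>X\<^sub>n = \<Sum>\<^sub>i a\<^sub>i v\<^sub>n\<^sub>-\<^sub>i\<close> with \<open>v\<^sub>0 = X\<^sub>0\<close>,
  \<open>v\<^sub>n = V\<^sub>n\<close> for \<open>n \<ge> 1\<close> and \<open>a\<close> the power series inverse of \<open>(1 - \<Sum>\<^sub>i \<theta>\<^sub>i z\<^sup>i)(1 - \<rho>z)\<close>, which is
  absolutely summable because \<open>\<parallel>\<theta>\<parallel>\<^sub>1 < 1\<close> and \<open>\<bar>\<rho>\<bar> < 1\<close> (\<open>ar_impulse_response\<close>).  Treating \<open>X\<^sub>0\<close> as one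
  more noise value disposes of the initial condition, since a single value of \<open>v\<close> enters one summand of
  each time average and vanishes after division by \<open>n\<close>.

  The only probabilistic input is that almost surely \<open>(1/n) \<Sum>\<^sub>k V\<^sub>k V\<^sub>k\<^sub>+\<^sub>h\<close> tends to \<open>\<sigma>\<^sup>2\<close> for \<open>h = 0\<close> and
  to \<open>0\<close> for \<open>h \<ge> 1\<close>.  For \<open>h = 0\<close> this is a strong law of large numbers for nonnegative integrable
  variables (\<open>strong_law_nonneg\<close>, by Etemadi's method); for \<open>h \<ge> 1\<close> the summands are orthogonal with constant
  variance (\<open>average_lagged_products_tendsto_0\<close>).

  Everything else holds for each trajectory on which these limits exist.  The empirical
  autocovariances of \<open>X\<close> converge to a function \<open>\<gamma>\<close>, by dominated convergence over the filter
  coefficients (\<open>has_lag_cov_convolve\<close>).  The limit is even, satisfies the Yule-Walker equations of the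
  autoregression of order \<open>p + 1\<close> with coefficients \<open>\<beta>\<^sub>1, \<dots>, \<beta>\<^sub>p, -\<theta>\<^sub>p\<rho>\<close>, and is positive definite.
  With \<open>c = \<theta>\<^sub>p\<rho>\<close>, the first \<open>p\<close> Yule-Walker equations read \<open>(I + cJ) g = \<Gamma>\<beta>\<close> for the Toeplitz matrix
  \<open>\<Gamma>\<close> of \<open>\<gamma>\<close> and \<open>g = (\<gamma>(1), \<dots>, \<gamma>(p))'\<close>; since \<open>J\<close> commutes with \<open>\<Gamma>\<close> and \<open>J\<^sup>2 = I\<close>, their
  solution is \<open>g = \<Gamma>\<theta>\<^sup>*\<close>, so the least squares estimator of \<open>\<theta>\<close> converges to \<open>\<theta>\<^sup>*\<close>.  The numerator and
  the denominator of the estimator of \<open>\<rho>\<close> are quadratic forms, with empirical autocovariances as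
  coefficients, in \<open>1\<close> followed by the negated estimate of \<open>\<theta>\<close>, so their averages
  converge to the lag-one covariance \<open>Q\<^sub>1\<close> and the variance \<open>Q\<^sub>0 > 0\<close> of the
  limiting prediction error.  The normal equations make almost all terms of these forms vanish, and
  the Yule-Walker equation of order \<open>p + 1\<close> yields \<open>Q\<^sub>1 = c \<theta>\<^sup>*\<^sub>p Q\<^sub>0\<close>.
\<close>

section \<open>Averages along geometric subsequences\<close>

definition geo :: "real \<Rightarrow> nat \<Rightarrow> nat" where
  "geo q n = nat \<lceil>q ^ n\<rceil>"

lemma geo_bounds:
  assumes "q > 1"
  shows "q ^ n \<le> real (geo q n)" "real (geo q n) \<le> q ^ n + 1" "real (geo q n) \<le> 2 * q ^ n" "geo q n \<ge> 1"
proof -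
  have 1: "q ^ n \<ge> 1" using assms by simp
  have c: "real (geo q n) = of_int \<lceil>q ^ n\<rceil>"
    unfolding geo_def using 1 by (simp add: le_ceiling_iff order_less_le_trans)
  show a: "q ^ n \<le> real (geo q n)" unfolding c by (rule le_of_int_ceiling)
  show b: "real (geo q n) \<le> q ^ n + 1" unfolding c by (rule of_int_ceiling_le_add_one)
  show "real (geo q n) \<le> 2 * q ^ n" using b 1 by linarith
  show "geo q n \<ge> 1" using a 1 by linarith
qed

lemma real_power_at_top:
  fixes q :: real
  assumes "q > 1"
  shows "filterlim (\<lambda>n. q ^ n) at_top sequentially"
  unfolding filterlim_at_top
proof
  fix y
  obtain m where "y < q ^ m" using real_arch_pow[OF assms] by blast
  hence "y \<le> q ^ n" if "n \<ge> m" for n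
    using power_increasing[OF that, of q] assms by linarith
  thus "\<forall>\<^sub>F n in sequentially. y \<le> q ^ n" by (auto simp: eventually_sequentially)
qed

lemma geo_ratio:
  assumes q: "q > 1"
  shows "(\<lambda>n. real (geo q (Suc n)) / real (geo q n)) \<longlonglongrightarrow> q"
proof -
  have 1: "(\<lambda>n. real (geo q n) / q ^ n) \<longlonglongrightarrow> 1"
  proof (rule tendsto_sandwich[where f="\<lambda>_. 1" and h="\<lambda>n. 1 + (1 / q) ^ n"])
    show "\<forall>\<^sub>F n in sequentially. 1 \<le> real (geo q n) / q ^ n"
      using geo_bounds[OF q] q by (intro always_eventually) simp
    show "\<forall>\<^sub>F n in sequentially. real (geo q n) / q ^ n \<le> 1 + (1 / q) ^ n"
      using geo_bounds[OF q] q by (intro always_eventually) (simp add: field_simps)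
    have "(\<lambda>n. (1 / q) ^ n) \<longlonglongrightarrow> 0" using q by (intro LIMSEQ_power_zero) simp
    from tendsto_add[OF tendsto_const this, of 1] show "(\<lambda>n. 1 + (1 / q) ^ n) \<longlonglongrightarrow> 1" by simp
  qed simp
  have "(\<lambda>n. q * (real (geo q (Suc n)) / q ^ Suc n) / (real (geo q n) / q ^ n)) \<longlonglongrightarrow> q * 1 / 1"
    by (intro tendsto_intros LIMSEQ_Suc[OF 1] 1) auto
  moreover have "q * (real (geo q (Suc n)) / q ^ Suc n) / (real (geo q n) / q ^ n)
     = real (geo q (Suc n)) / real (geo q n)" for n
    using q by (simp add: field_simps)
  ultimately show ?thesis by (simp only: mult_1_right div_by_1)
qed

text \<open>
  Let \<open>k\<^sub>j = geo q j\<close>.  For \<open>k\<^sub>j \<le> n \<le> k\<^sub>j\<^sub>+\<^sub>1\<close> monotonicity gives \<open>A(k\<^sub>j) / k\<^sub>j\<^sub>+\<^sub>1 \<le> A(n) / n \<le> A(k\<^sub>j\<^sub>+\<^sub>1) / k\<^sub>j\<close>, and the two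
  bounds tend to \<open>L/q\<close> and \<open>Lq\<close>.  Only the countably many ratios \<open>q = 1 + 1/(m+1)\<close> appear in the
  hypothesis, so that almost sure statements can be collected over \<open>m\<close>.
\<close>

lemma tendsto_average_of_geometric_times:
  fixes A :: "nat \<Rightarrow> real"
  assumes mono: "mono A" and nn: "\<And>n. A n \<ge> 0" and L: "L \<ge> 0"
    and sub: "\<And>m. (\<lambda>n. A (geo (1 + 1 / Suc m) n) / real (geo (1 + 1 / Suc m) n)) \<longlonglongrightarrow> L"
  shows "(\<lambda>n. A n / real n) \<longlonglongrightarrow> L"
proof (rule order_tendstoI)
  have key: "\<forall>\<^sub>F n in sequentially. l < A n / real n \<and> A n / real n < u"
    if l: "l < L / (1 + 1 / Suc m)" and u: "L * (1 + 1 / Suc m) < u" for l u m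
  proof -
    define q where "q = 1 + 1 / real (Suc m)"
    have q: "q > 1" unfolding q_def by simp
    define k where "k = geo q"
    define j where "j n = nat \<lfloor>log q (real n)\<rfloor>" for n
    have kpos: "real (k i) > 0" for i using geo_bounds(4)[OF q, of i] unfolding k_def by simp
    have ratio: "(\<lambda>n. real (k (Suc n)) / real (k n)) \<longlonglongrightarrow> q"
      unfolding k_def by (rule geo_ratio[OF q])
    have s: "(\<lambda>n. A (k n) / real (k n)) \<longlonglongrightarrow> L"
      using sub[of m] unfolding k_def q_def .
    have j: "filterlim j at_top sequentially"
    proof -
      have "filterlim (\<lambda>n. 1 / ln q * ln (real n)) at_top sequentially"
        using q by (intro filterlim_tendsto_pos_mult_at_top[OF tendsto_const]
             filterlim_compose[OF ln_at_top] filterlim_real_sequentially) auto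
      hence "filterlim (\<lambda>n. log q (real n)) at_top sequentially"
        by (simp add: log_def)
      thus ?thesis unfolding j_def
        by (intro filterlim_compose[OF filterlim_nat_sequentially] filterlim_compose[OF filterlim_floor_sequentially])
    qed
    have up: "(\<lambda>n. A (k (Suc n)) / real (k n)) \<longlonglongrightarrow> L * q"
    proof -
      have "(\<lambda>n. A (k (Suc n)) / real (k (Suc n)) * (real (k (Suc n)) / real (k n))) \<longlonglongrightarrow> L * q"
        by (intro tendsto_mult LIMSEQ_Suc[OF s] ratio)
      thus ?thesis using kpos by (simp add: less_imp_neq[THEN not_sym])
    qed
    have dn: "(\<lambda>n. A (k n) / real (k (Suc n))) \<longlonglongrightarrow> L / q"
    proof -
      have "(\<lambda>n. A (k n) / real (k n) / (real (k (Suc n)) / real (k n))) \<longlonglongrightarrow> L / q"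
        using q by (intro tendsto_divide s ratio) simp
      thus ?thesis using kpos by (simp add: less_imp_neq[THEN not_sym])
    qed
    have "\<forall>\<^sub>F n in sequentially. A (k (Suc (j n))) / real (k (j n)) < u"
      using order_tendstoD(2)[OF filterlim_compose[OF up j], of u] u unfolding q_def by simp
    moreover have "\<forall>\<^sub>F n in sequentially. l < A (k (j n)) / real (k (Suc (j n)))"
      using order_tendstoD(1)[OF filterlim_compose[OF dn j], of l] l unfolding q_def by simp
    ultimately show ?thesis using eventually_ge_at_top[of 1]
    proof eventually_elim
      case (elim n)
      have n1: "real n \<ge> 1" using elim by simp
      have "log q (real n) \<ge> 0" using n1 q by simp
      hence J: "real (j n) \<le> log q (real n)" "log q (real n) < real (j n) + 1"
        unfolding j_def by linarith+
      have "q powr real (j n) \<le> real n" using J(1) q n1 by (simp add: le_log_iff)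
      hence a: "q ^ j n \<le> real n" using q by (simp add: powr_realpow)
      have "real n < q powr real (Suc (j n))" using J(2) q n1 by (simp add: log_less_iff add.commute)
      hence b: "real n < q ^ Suc (j n)" using q by (simp only: powr_realpow)
      have ka: "k (j n) \<le> n" unfolding k_def geo_def using a by (simp add: nat_le_iff ceiling_le_iff)
      have kb: "n \<le> k (Suc (j n))" using geo_bounds(1)[OF q, of "Suc (j n)"] b unfolding k_def by linarith
      have "A n / real n \<le> A (k (Suc (j n))) / real (k (j n))"
        using monoD[OF mono kb] kpos[of "j n"] ka nn by (intro frac_le) auto
      moreover have "A (k (j n)) / real (k (Suc (j n))) \<le> A n / real n"
        using monoD[OF mono ka] n1 kb nn by (intro frac_le) auto
      ultimately show ?case using elim by linarith
    qed
  qed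
  have q1: "(\<lambda>m. 1 + 1 / real (Suc m)) \<longlonglongrightarrow> 1 + 0"
    by (intro tendsto_add tendsto_const lim_1_over_n[THEN LIMSEQ_Suc])
  have lq: "(\<lambda>m. L / (1 + 1 / real (Suc m))) \<longlonglongrightarrow> L"
    using tendsto_divide[OF tendsto_const q1, of L] by simp
  have uq: "(\<lambda>m. L * (1 + 1 / real (Suc m))) \<longlonglongrightarrow> L"
    using tendsto_mult[OF tendsto_const q1, of L] by simp
  show "\<forall>\<^sub>F n in sequentially. a < A n / real n" if a: "a < L" for a
  proof -
    obtain m where "a < L / (1 + 1 / real (Suc m))"
      using order_tendstoD(1)[OF lq a] eventually_sequentially by auto
    from key[OF this less_add_one] show ?thesis by (rule eventually_mono) simp
  qed
  show "\<forall>\<^sub>F n in sequentially. A n / real n < a" if a: "L < a" for a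
  proof -
    obtain m where "L * (1 + 1 / real (Suc m)) < a"
      using order_tendstoD(2)[OF uq a] eventually_sequentially by auto
    from key[OF _ this, of "L / (1 + 1 / Suc m) - 1"] show ?thesis by (auto elim: eventually_mono)
  qed
qed

lemma AE_tendsto_0_of_summable_integral:
  fixes f :: "nat \<Rightarrow> 'a \<Rightarrow> real"
  assumes int: "\<And>n. integrable M (f n)" and nn: "\<And>n x. f n x \<ge> 0"
    and sm: "summable (\<lambda>n. integral\<^sup>L M (f n))"
  shows "AE x in M. (\<lambda>n. f n x) \<longlonglongrightarrow> 0"
proof -
  have [measurable]: "f n \<in> borel_measurable M" for n using int by auto
  have "(\<integral>\<^sup>+x. (\<Sum>n. ennreal (f n x)) \<partial>M) = (\<Sum>n. ennreal (integral\<^sup>L M (f n)))"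
    using int nn by (subst nn_integral_suminf) (auto simp: nn_integral_eq_integral)
  also have "\<dots> = ennreal (\<Sum>n. integral\<^sup>L M (f n))"
    using nn by (intro suminf_ennreal_eq summable_sums[OF sm]) (simp add: integral_nonneg_AE)
  finally have "AE x in M. (\<Sum>n. ennreal (f n x)) \<noteq> \<infinity>"
    by (intro nn_integral_PInf_AE) simp_all
  thus ?thesis
  proof eventually_elim
    case (elim x)
    thus ?case using summable_suminf_not_top[of "\<lambda>n. f n x"] nn
      by (intro summable_LIMSEQ_zero) auto
  qed
qed

text \<open>
  In the next two lemmas the sum is geometric and comparable to its extreme term, at the threshold
  where \<open>q\<^sup>n\<close> passes \<open>y\<close>.  Integrated against the law of an integrable variable they bound the sums of
  tail probabilities and of truncated second moments in Etemadi's argument by the first moment alone.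
\<close>

lemma sum_geometric_below:
  fixes q y :: real
  assumes q: "q > 1" and y: "y \<ge> 0"
  shows "(\<Sum>n<N. if q ^ n < y then q ^ n else 0) \<le> q / (q - 1) * y"
proof (cases "\<exists>n<N. q ^ n < y")
  case False
  hence "(\<Sum>n<N. if q ^ n < y then q ^ n else 0) = 0" by (intro sum.neutral) auto
  thus ?thesis using assms by simp
next
  case True
  define m where "m = Max {n. n < N \<and> q ^ n < y}"
  have m: "q ^ m < y" and mx: "\<And>n. n < N \<Longrightarrow> q ^ n < y \<Longrightarrow> n \<le> m"
    using Max_in[of "{n. n < N \<and> q ^ n < y}"] True unfolding m_def by (auto intro: Max_ge)
  have "(\<Sum>n<N. if q ^ n < y then q ^ n else 0) = (\<Sum>n\<in>{n. n < N \<and> q ^ n < y}. q ^ n)"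
    by (rule sum.mono_neutral_cong_right) auto
  also have "\<dots> \<le> (\<Sum>n<Suc m. q ^ n)"
    using mx q by (intro sum_mono2) (auto simp: less_Suc_eq_le)
  also have "\<dots> = (q ^ Suc m - 1) / (q - 1)" using q by (subst geometric_sum) auto
  also have "\<dots> \<le> q / (q - 1) * q ^ m" using q by (simp add: divide_right_mono)
  also have "\<dots> \<le> q / (q - 1) * y" using q m by (intro mult_left_mono) auto
  finally show ?thesis .
qed

lemma sum_geometric_above:
  fixes q y :: real
  assumes q: "q > 1" and y: "y \<ge> 0"
  shows "(\<Sum>n<N. if y \<le> q ^ n then y\<^sup>2 / q ^ n else 0) \<le> q / (q - 1) * y"
proof (cases "\<exists>n. y \<le> q ^ n")
  case False
  hence "(\<Sum>n<N. if y \<le> q ^ n then y\<^sup>2 / q ^ n else 0) = 0" by (intro sum.neutral) auto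
  thus ?thesis using assms by simp
next
  case True
  define m where "m = (LEAST n. y \<le> q ^ n)"
  have m: "y \<le> q ^ m" and mn: "\<And>n. y \<le> q ^ n \<Longrightarrow> m \<le> n"
    using True unfolding m_def by (auto intro: LeastI Least_le)
  have "(\<Sum>n<N. if y \<le> q ^ n then y\<^sup>2 / q ^ n else 0) = (\<Sum>n\<in>{n. n < N \<and> y \<le> q ^ n}. y\<^sup>2 / q ^ n)"
    by (rule sum.mono_neutral_cong_right) auto
  also have "\<dots> \<le> (\<Sum>n\<in>{m..<m+N}. y\<^sup>2 / q ^ n)"
    using mn q by (intro sum_mono2) (auto intro: trans_less_add2)
  also have "\<dots> = (\<Sum>i<N. y\<^sup>2 / q ^ m * (1 / q) ^ i)"
    using sum.shift_bounds_nat_ivl[of "\<lambda>n. y\<^sup>2 / q ^ n" 0 m N]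
    by (simp add: add.commute power_add lessThan_atLeast0 power_divide mult.commute)
  also have "\<dots> = y\<^sup>2 / q ^ m * (\<Sum>i<N. (1 / q) ^ i)" by (simp add: sum_distrib_left)
  also have "\<dots> \<le> y\<^sup>2 / q ^ m * (1 / (1 - 1 / q))"
    using q by (intro mult_left_mono, subst sum_gp_strict) (auto simp: divide_right_mono)
  also have "1 / (1 - 1 / q) = q / (q - 1)" using q by (simp add: field_simps)
  also have "y\<^sup>2 / q ^ m * (q / (q - 1)) \<le> y * (q / (q - 1))"
    using q m y by (intro mult_right_mono) (auto simp: power2_eq_square divide_le_eq intro: mult_left_mono)
  finally show ?thesis by (simp only: mult.commute)
qed

section \<open>A strong law of large numbers\<close>

lemma (in prob_space) expectation_mult_indep_vars:
  fixes W :: "'i \<Rightarrow> 'a \<Rightarrow> real"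
  assumes "indep_vars (\<lambda>_. borel) W J" "k \<in> J" "l \<in> J" "k \<noteq> l"
    and "\<And>i. i \<in> J \<Longrightarrow> integrable M (W i)"
  shows "integrable M (\<lambda>\<omega>. W k \<omega> * W l \<omega>)"
    and "expectation (\<lambda>\<omega>. W k \<omega> * W l \<omega>) = expectation (W k) * expectation (W l)"
proof -
  have ind: "indep_vars (\<lambda>_. borel) W {k, l}"
    by (rule indep_vars_subset[OF assms(1)]) (use assms in auto)
  have int: "integrable M (W i)" if "i \<in> {k, l}" for i using assms that by auto
  show "integrable M (\<lambda>\<omega>. W k \<omega> * W l \<omega>)"
    using indep_vars_integrable[OF _ ind int] assms by simp
  show "expectation (\<lambda>\<omega>. W k \<omega> * W l \<omega>) = expectation (W k) * expectation (W l)"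
    using indep_vars_lebesgue_integral[OF _ ind int] assms by simp
qed

lemma integral_sum_square_orthogonal:
  fixes W :: "'i \<Rightarrow> 'a \<Rightarrow> real"
  assumes fin: "finite I"
    and int: "\<And>k l. k \<in> I \<Longrightarrow> l \<in> I \<Longrightarrow> integrable M (\<lambda>\<omega>. W k \<omega> * W l \<omega>)"
    and orth: "\<And>k l. k \<in> I \<Longrightarrow> l \<in> I \<Longrightarrow> k \<noteq> l \<Longrightarrow> (\<integral>\<omega>. W k \<omega> * W l \<omega> \<partial>M) = 0"
  shows "integrable M (\<lambda>\<omega>. (\<Sum>k\<in>I. W k \<omega>)\<^sup>2)"
    and "(\<integral>\<omega>. (\<Sum>k\<in>I. W k \<omega>)\<^sup>2 \<partial>M) = (\<Sum>k\<in>I. \<integral>\<omega>. (W k \<omega>)\<^sup>2 \<partial>M)"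
proof -
  have eq: "(\<Sum>k\<in>I. W k \<omega>)\<^sup>2 = (\<Sum>k\<in>I. \<Sum>l\<in>I. W k \<omega> * W l \<omega>)" for \<omega>
    by (simp add: power2_eq_square sum_product)
  show "integrable M (\<lambda>\<omega>. (\<Sum>k\<in>I. W k \<omega>)\<^sup>2)"
    unfolding eq by (intro Bochner_Integration.integrable_sum int)
  have "(\<integral>\<omega>. (\<Sum>k\<in>I. W k \<omega>)\<^sup>2 \<partial>M) = (\<Sum>k\<in>I. \<Sum>l\<in>I. \<integral>\<omega>. W k \<omega> * W l \<omega> \<partial>M)"
    unfolding eq using int by (simp add: Bochner_Integration.integral_sum)
  also have "\<dots> = (\<Sum>k\<in>I. \<integral>\<omega>. (W k \<omega>)\<^sup>2 \<partial>M)"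
  proof (rule sum.cong[OF refl])
    fix k assume k: "k \<in> I"
    have "(\<Sum>l\<in>I. \<integral>\<omega>. W k \<omega> * W l \<omega> \<partial>M) = (\<Sum>l\<in>{k}. \<integral>\<omega>. W k \<omega> * W l \<omega> \<partial>M)"
      using fin k orth by (intro sum.mono_neutral_right) auto
    thus "(\<Sum>l\<in>I. \<integral>\<omega>. W k \<omega> * W l \<omega> \<partial>M) = (\<integral>\<omega>. (W k \<omega>)\<^sup>2 \<partial>M)"
      by (simp add: power2_eq_square)
  qed
  finally show "(\<integral>\<omega>. (\<Sum>k\<in>I. W k \<omega>)\<^sup>2 \<partial>M) = (\<Sum>k\<in>I. \<integral>\<omega>. (W k \<omega>)\<^sup>2 \<partial>M)" .
qed

text \<open>
  Orthogonality makes the second moment of an average of \<open>m\<close> terms at most \<open>c/m\<close>.  For constant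
  \<open>c\<close> these bounds are summable along a geometric subsequence, though not over all \<open>m\<close>.  The summands may
  change with \<open>n\<close>, to allow a truncation level that grows along the subsequence.
\<close>

lemma AE_geo_average_tendsto_0:
  fixes W :: "nat \<Rightarrow> nat \<Rightarrow> 'a \<Rightarrow> real"
  assumes q: "q > 1"
    and int: "\<And>n k l. integrable M (\<lambda>\<omega>. W n k \<omega> * W n l \<omega>)"
    and orth: "\<And>n k l. 1 \<le> k \<Longrightarrow> 1 \<le> l \<Longrightarrow> k \<noteq> l \<Longrightarrow> (\<integral>\<omega>. W n k \<omega> * W n l \<omega> \<partial>M) = 0"
    and bnd: "\<And>n k. 1 \<le> k \<Longrightarrow> (\<integral>\<omega>. (W n k \<omega>)\<^sup>2 \<partial>M) \<le> c n"
    and sm: "summable (\<lambda>n. c n / q ^ n)"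
  shows "AE \<omega> in M. (\<lambda>n. (\<Sum>k=1..geo q n. W n k \<omega>) / geo q n) \<longlonglongrightarrow> 0"
proof -
  let ?f = "\<lambda>n \<omega>. ((\<Sum>k=1..geo q n. W n k \<omega>) / geo q n)\<^sup>2"
  have c0: "c n \<ge> 0" for n
    using order.trans[OF _ bnd[of 1 n]] by (simp add: integral_nonneg_AE)
  have int': "integrable M (\<lambda>\<omega>. (\<Sum>k=1..geo q n. W n k \<omega>)\<^sup>2)"
    and eq: "(\<integral>\<omega>. (\<Sum>k=1..geo q n. W n k \<omega>)\<^sup>2 \<partial>M) = (\<Sum>k=1..geo q n. \<integral>\<omega>. (W n k \<omega>)\<^sup>2 \<partial>M)" for n
    by (rule integral_sum_square_orthogonal; use int orth in simp)+
  have le: "integral\<^sup>L M (?f n) \<le> c n / q ^ n" for n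
  proof -
    have "integral\<^sup>L M (?f n) = (\<Sum>k=1..geo q n. \<integral>\<omega>. (W n k \<omega>)\<^sup>2 \<partial>M) / (geo q n)\<^sup>2"
      by (simp only: power_divide eq[symmetric]) simp
    also have "\<dots> \<le> (\<Sum>k=1..geo q n. c n) / (geo q n)\<^sup>2"
      by (intro divide_right_mono sum_mono bnd) auto
    also have "\<dots> = c n / geo q n" by (simp add: power2_eq_square)
    also have "\<dots> \<le> c n / q ^ n"
      using geo_bounds[OF q, of n] q c0 by (intro divide_left_mono) auto
    finally show ?thesis .
  qed
  have "AE \<omega> in M. (\<lambda>n. ?f n \<omega>) \<longlonglongrightarrow> 0"
  proof (rule AE_tendsto_0_of_summable_integral)
    show "integrable M (?f n)" for n using int'[of n] by (simp add: power_divide)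
    show "summable (\<lambda>n. integral\<^sup>L M (?f n))"
      by (rule summable_comparison_test'[OF sm, of 0]) (use le in \<open>simp add: integral_nonneg_AE\<close>)
  qed simp
  thus ?thesis
  proof eventually_elim
    case (elim \<omega>)
    from tendsto_real_sqrt[OF elim] have "(\<lambda>n. \<bar>(\<Sum>k=1..geo q n. W n k \<omega>) / geo q n\<bar>) \<longlonglongrightarrow> 0"
      by (simp only: real_sqrt_abs real_sqrt_zero)
    thus ?case by (rule tendsto_rabs_zero_cancel)
  qed
qed

lemma (in prob_space) identically_distributed_integral:
  fixes Y Z :: "'a \<Rightarrow> real" and g :: "real \<Rightarrow> real"
  assumes "distr M borel Y = distr M borel Z"
    and [measurable]: "Y \<in> borel_measurable M" "Z \<in> borel_measurable M" "g \<in> borel_measurable borel"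
  shows "expectation (\<lambda>\<omega>. g (Y \<omega>)) = expectation (\<lambda>\<omega>. g (Z \<omega>))"
    and "integrable M (\<lambda>\<omega>. g (Y \<omega>)) \<longleftrightarrow> integrable M (\<lambda>\<omega>. g (Z \<omega>))"
proof -
  show "expectation (\<lambda>\<omega>. g (Y \<omega>)) = expectation (\<lambda>\<omega>. g (Z \<omega>))"
    using integral_distr[of Y M borel g] integral_distr[of Z M borel g] assms by simp
  show "integrable M (\<lambda>\<omega>. g (Y \<omega>)) \<longleftrightarrow> integrable M (\<lambda>\<omega>. g (Z \<omega>))"
    using integrable_distr_eq[of Y M borel g] integrable_distr_eq[of Z M borel g] assms by simp
qed

text \<open>
  Etemadi's truncation: all of the first \<open>geo q n\<close> variables are cut at the same level \<open>q\<^sup>n\<close>, so that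
  they stay identically distributed.  The centred truncated averages tend to \<open>0\<close> by their second
  moments, the expected number of variables above the level is summable in \<open>n\<close>, and the truncated mean
  converges to the full one.
\<close>

lemma (in prob_space) strong_law_nonneg_geo:
  fixes Y :: "nat \<Rightarrow> 'a \<Rightarrow> real"
  assumes q: "q > 1"
    and ind: "indep_vars (\<lambda>_. borel) Y {1..}"
    and id: "\<And>k. k \<ge> 1 \<Longrightarrow> distr M borel (Y k) = distr M borel (Y 1)"
    and int: "integrable M (Y 1)" and nn: "\<And>k \<omega>. Y k \<omega> \<ge> 0"
  shows "AE \<omega> in M. (\<lambda>n. (\<Sum>k=1..geo q n. Y k \<omega>) / geo q n) \<longlonglongrightarrow> expectation (Y 1)"
proof -
  have meas: "Y k \<in> borel_measurable M" if "k \<ge> 1" for k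
    using ind that by (auto simp: indep_vars_def)
  note [measurable] = meas[of 1, simplified]
  define g where "g n y = (if y \<le> q ^ n then y else 0)" for n and y :: real
  have g [measurable]: "g n \<in> borel_measurable borel" for n unfolding g_def by measurable
  have gb: "\<bar>g n (Y k \<omega>)\<bar> \<le> q ^ n" for n k \<omega> using nn[of k \<omega>] q unfolding g_def by auto
  define c where "c n = expectation (\<lambda>\<omega>. g n (Y 1 \<omega>))" for n
  have gm: "(\<lambda>\<omega>. g n (Y k \<omega>)) \<in> borel_measurable M" if "k \<ge> 1" for n k
    using measurable_compose[OF meas[OF that] g] .
  have gi: "integrable M (\<lambda>\<omega>. g n (Y k \<omega>))" if "k \<ge> 1" for n k
    by (rule integrable_const_bound[where B="q ^ n"]) (use gb gm[OF that] in auto)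
  have ec: "expectation (\<lambda>\<omega>. g n (Y k \<omega>)) = c n" if "k \<ge> 1" for n k
    unfolding c_def by (rule identically_distributed_integral[OF id[OF that]]) (use meas that in auto)
  \<comment> \<open>the indices of \<open>Y\<close> start at one; the value zero for \<open>W n 0\<close> makes all products integrable\<close>
  define W where "W n k \<omega> = (if k \<ge> 1 then g n (Y k \<omega>) - c n else 0)" for n k \<omega>
  have Wm: "W n k \<in> borel_measurable M" for n k
    using gm[of k n] by (cases "k \<ge> 1") (auto simp: W_def[abs_def])
  have Wb: "\<bar>W n k \<omega>\<bar> \<le> q ^ n + \<bar>c n\<bar>" for n k \<omega>
    using gb[of n k \<omega>] by (auto simp: W_def)
  have WWi: "integrable M (\<lambda>\<omega>. W n k \<omega> * W n l \<omega>)" for n k l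
    by (rule integrable_const_bound[where B="(q ^ n + \<bar>c n\<bar>) * (q ^ n + \<bar>c n\<bar>)"])
       (use Wm in \<open>auto simp: abs_mult intro!: AE_I2 mult_mono Wb order.trans[OF abs_ge_zero Wb]\<close>)
  have Wi: "integrable M (W n k)" for n k
    by (rule integrable_const_bound[where B="q ^ n + \<bar>c n\<bar>"]) (use Wm Wb in auto)
  have Wind: "indep_vars (\<lambda>_. borel) (W n) {1..}" for n
  proof -
    have "indep_vars (\<lambda>_. borel) (\<lambda>k \<omega>. g n (Y k \<omega>) - c n) {1..}"
      by (rule indep_vars_compose2[OF ind]) measurable
    thus ?thesis by (rule indep_vars_cong[THEN iffD1, rotated -1]) (auto simp: W_def)
  qed
  have W0: "expectation (W n k) = 0" if "k \<ge> 1" for n k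
    using ec[OF that, of n] gi[OF that, of n] that by (simp add: W_def[abs_def] prob_space)
  have var: "expectation (\<lambda>\<omega>. (W n k \<omega>)\<^sup>2) \<le> expectation (\<lambda>\<omega>. (g n (Y 1 \<omega>))\<^sup>2)" if "k \<ge> 1" for n k
  proof -
    have g2: "integrable M (\<lambda>\<omega>. (g n (Y k \<omega>))\<^sup>2)"
      by (rule integrable_const_bound[where B="(q ^ n)\<^sup>2"])
         (use gb gm[OF that] in \<open>auto simp flip: abs_le_square_iff intro: order.trans[OF gb abs_ge_self]\<close>)
    have "expectation (\<lambda>\<omega>. (W n k \<omega>)\<^sup>2) = variance (\<lambda>\<omega>. g n (Y k \<omega>))"
      using that ec[OF that, of n] by (simp add: W_def)
    also have "\<dots> = expectation (\<lambda>\<omega>. (g n (Y k \<omega>))\<^sup>2) - (expectation (\<lambda>\<omega>. g n (Y k \<omega>)))\<^sup>2"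
      by (rule variance_eq[OF gi[OF that] g2])
    also have "\<dots> \<le> expectation (\<lambda>\<omega>. (g n (Y k \<omega>))\<^sup>2)" by simp
    also have "\<dots> = expectation (\<lambda>\<omega>. (g n (Y 1 \<omega>))\<^sup>2)"
      by (rule identically_distributed_integral[OF id[OF that], where g="\<lambda>y. (g n y)\<^sup>2"]) (use meas that in auto)
    finally show ?thesis .
  qed
  have g2i: "integrable M (\<lambda>\<omega>. (g n (Y 1 \<omega>))\<^sup>2)" for n
      by (rule integrable_const_bound[where B="(q ^ n)\<^sup>2"])
         (use gb in \<open>auto simp flip: abs_le_square_iff intro: order.trans[OF gb abs_ge_self]\<close>)
  have sm1: "summable (\<lambda>n. expectation (\<lambda>\<omega>. (g n (Y 1 \<omega>))\<^sup>2) / q ^ n)"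
  proof (rule summableI_nonneg_bounded)
    show "0 \<le> expectation (\<lambda>\<omega>. (g n (Y 1 \<omega>))\<^sup>2) / q ^ n" for n
      using q by (simp add: integral_nonneg_AE)
    show "(\<Sum>n<N. expectation (\<lambda>\<omega>. (g n (Y 1 \<omega>))\<^sup>2) / q ^ n) \<le> expectation (\<lambda>\<omega>. q / (q - 1) * Y 1 \<omega>)" for N
    proof -
      have "(\<Sum>n<N. expectation (\<lambda>\<omega>. (g n (Y 1 \<omega>))\<^sup>2) / q ^ n)
          = expectation (\<lambda>\<omega>. \<Sum>n<N. (g n (Y 1 \<omega>))\<^sup>2 / q ^ n)"
        using g2i by (subst Bochner_Integration.integral_sum) auto
      also have "\<dots> \<le> expectation (\<lambda>\<omega>. q / (q - 1) * Y 1 \<omega>)"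
      proof (rule integral_mono)
        show "integrable M (\<lambda>\<omega>. \<Sum>n<N. (g n (Y 1 \<omega>))\<^sup>2 / q ^ n)"
          using g2i by (intro Bochner_Integration.integrable_sum) auto
        show "integrable M (\<lambda>\<omega>. q / (q - 1) * Y 1 \<omega>)" using int by simp
        fix \<omega>
        have "(\<Sum>n<N. (g n (Y 1 \<omega>))\<^sup>2 / q ^ n)
           = (\<Sum>n<N. if Y 1 \<omega> \<le> q ^ n then (Y 1 \<omega>)\<^sup>2 / q ^ n else 0)"
          by (intro sum.cong) (auto simp: g_def)
        thus "(\<Sum>n<N. (g n (Y 1 \<omega>))\<^sup>2 / q ^ n) \<le> q / (q - 1) * Y 1 \<omega>"
          using sum_geometric_above[OF q nn[of 1 \<omega>], of N] by simp
      qed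
      finally show ?thesis .
    qed
  qed
  have AE_W: "AE \<omega> in M. (\<lambda>n. (\<Sum>k=1..geo q n. W n k \<omega>) / geo q n) \<longlonglongrightarrow> 0"
  proof (rule AE_geo_average_tendsto_0[OF q WWi _ var sm1])
    fix n k l :: nat assume "1 \<le> k" "1 \<le> l" "k \<noteq> l"
    thus "expectation (\<lambda>\<omega>. W n k \<omega> * W n l \<omega>) = 0"
      using expectation_mult_indep_vars(2)[OF Wind, of k l n] Wi W0 by simp
  qed
  \<comment> \<open>the number of truncated variables: an integer, hence zero as soon as it is below one\<close>
  define B where "B n \<omega> = (\<Sum>k=1..geo q n. if q ^ n < Y k \<omega> then 1 else 0 :: real)" for n \<omega>
  have AE_B: "AE \<omega> in M. (\<lambda>n. B n \<omega>) \<longlonglongrightarrow> 0"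
  proof (rule AE_tendsto_0_of_summable_integral)
    let ?i = "\<lambda>n y. if q ^ n < y then 1 else (0::real)"
    have ii: "integrable M (\<lambda>\<omega>. ?i n (Y k \<omega>))" if "k \<ge> 1" for n k
      using meas[OF that] by (intro integrable_const_bound[where B=1]) auto
    show "integrable M (B n)" for n
      unfolding B_def using ii by (intro Bochner_Integration.integrable_sum) auto
    show "B n \<omega> \<ge> 0" for n \<omega> unfolding B_def by (intro sum_nonneg) auto
    have eB: "expectation (B n) = geo q n * expectation (\<lambda>\<omega>. ?i n (Y 1 \<omega>))" for n
    proof -
      have "expectation (B n) = (\<Sum>k=1..geo q n. expectation (\<lambda>\<omega>. ?i n (Y k \<omega>)))"
        unfolding B_def using ii by (subst Bochner_Integration.integral_sum) auto
      also have "\<dots> = (\<Sum>k=1..geo q n. expectation (\<lambda>\<omega>. ?i n (Y 1 \<omega>)))"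
        by (intro sum.cong refl identically_distributed_integral[OF id]) (use meas in auto)
      finally show ?thesis by simp
    qed
    show "summable (\<lambda>n. expectation (B n))"
    proof (rule summableI_nonneg_bounded)
      show "0 \<le> expectation (B n)" for n unfolding eB by (simp add: integral_nonneg_AE)
      show "(\<Sum>n<N. expectation (B n)) \<le> expectation (\<lambda>\<omega>. 2 * (q / (q - 1) * Y 1 \<omega>))" for N
      proof -
        have "(\<Sum>n<N. expectation (B n)) \<le> (\<Sum>n<N. 2 * q ^ n * expectation (\<lambda>\<omega>. ?i n (Y 1 \<omega>)))"
          unfolding eB using geo_bounds(3)[OF q] by (intro sum_mono mult_right_mono) (auto simp: integral_nonneg_AE)
        also have "\<dots> = expectation (\<lambda>\<omega>. \<Sum>n<N. 2 * q ^ n * ?i n (Y 1 \<omega>))"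
          using ii by (subst Bochner_Integration.integral_sum) auto
        also have "\<dots> \<le> expectation (\<lambda>\<omega>. 2 * (q / (q - 1) * Y 1 \<omega>))"
        proof (rule integral_mono)
          show "integrable M (\<lambda>\<omega>. \<Sum>n<N. 2 * q ^ n * ?i n (Y 1 \<omega>))"
            using ii by (intro Bochner_Integration.integrable_sum) auto
          show "integrable M (\<lambda>\<omega>. 2 * (q / (q - 1) * Y 1 \<omega>))" using int by simp
          fix \<omega>
          have "(\<Sum>n<N. 2 * q ^ n * ?i n (Y 1 \<omega>)) = 2 * (\<Sum>n<N. if q ^ n < Y 1 \<omega> then q ^ n else 0)"
            by (subst sum_distrib_left, intro sum.cong) auto
          thus "(\<Sum>n<N. 2 * q ^ n * ?i n (Y 1 \<omega>)) \<le> 2 * (q / (q - 1) * Y 1 \<omega>)"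
            using sum_geometric_below[OF q nn[of 1 \<omega>], of N] by simp
        qed
        finally show ?thesis .
      qed
    qed
  qed
  have c: "c \<longlonglongrightarrow> expectation (Y 1)"
    unfolding c_def
  proof (rule integral_dominated_convergence[where w="Y 1"])
    show "AE \<omega> in M. (\<lambda>n. g n (Y 1 \<omega>)) \<longlonglongrightarrow> Y 1 \<omega>"
    proof (intro AE_I2 tendsto_eventually)
      fix \<omega>
      have "filterlim (\<lambda>n. q ^ n) at_top sequentially" using q by (rule real_power_at_top)
      hence "\<forall>\<^sub>F n in sequentially. Y 1 \<omega> \<le> q ^ n" by (auto simp: filterlim_at_top)
      thus "\<forall>\<^sub>F n in sequentially. g n (Y 1 \<omega>) = Y 1 \<omega>" by (rule eventually_mono) (simp add: g_def)
    qed
    show "AE \<omega> in M. norm (g n (Y 1 \<omega>)) \<le> Y 1 \<omega>" for n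
      using nn by (auto simp: g_def)
  qed (use int in auto)
  from AE_W AE_B show ?thesis
  proof eventually_elim
    case (elim \<omega>)
    have "\<forall>\<^sub>F n in sequentially. B n \<omega> < 1"
      using order_tendstoD(2)[OF elim(2), of 1] by simp
    hence ev: "\<forall>\<^sub>F n in sequentially. (\<Sum>k=1..geo q n. W n k \<omega>) / geo q n + c n = (\<Sum>k=1..geo q n. Y k \<omega>) / geo q n"
    proof eventually_elim
      case (elim n)
      have small: "Y k \<omega> \<le> q ^ n" if k: "k \<in> {1..geo q n}" for k
      proof (rule ccontr)
        assume "\<not> Y k \<omega> \<le> q ^ n"
        hence "1 \<le> B n \<omega>" unfolding B_def
          using member_le_sum[OF k, of "\<lambda>k. if q ^ n < Y k \<omega> then 1 else 0 :: real"] by simp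
        thus False using elim by simp
      qed
      have "(\<Sum>k=1..geo q n. W n k \<omega>) = (\<Sum>k=1..geo q n. Y k \<omega> - c n)"
        using small by (intro sum.cong) (auto simp: W_def g_def)
      also have "\<dots> = (\<Sum>k=1..geo q n. Y k \<omega>) - geo q n * c n" by (simp add: sum_subtractf)
      finally show ?case using geo_bounds(4)[OF q, of n] by (simp add: field_simps)
    qed
    from tendsto_add[OF elim(1) c] have "(\<lambda>n. (\<Sum>k=1..geo q n. W n k \<omega>) / geo q n + c n) \<longlonglongrightarrow> expectation (Y 1)" by simp
    thus ?case by (rule Lim_transform_eventually[OF _ ev])
  qed
qed

lemma (in prob_space) strong_law_nonneg:
  fixes Y :: "nat \<Rightarrow> 'a \<Rightarrow> real"
  assumes ind: "indep_vars (\<lambda>_. borel) Y {1..}"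
    and id: "\<And>k. k \<ge> 1 \<Longrightarrow> distr M borel (Y k) = distr M borel (Y 1)"
    and int: "integrable M (Y 1)" and nn: "\<And>k \<omega>. Y k \<omega> \<ge> 0"
  shows "AE \<omega> in M. (\<lambda>n. (\<Sum>k=1..n. Y k \<omega>) / n) \<longlonglongrightarrow> expectation (Y 1)"
proof -
  have "AE \<omega> in M. \<forall>m. (\<lambda>n. (\<Sum>k=1..geo (1 + 1 / Suc m) n. Y k \<omega>) / geo (1 + 1 / Suc m) n)
          \<longlonglongrightarrow> expectation (Y 1)"
    by (subst AE_all_countable, intro allI strong_law_nonneg_geo[OF _ assms]) auto
  thus ?thesis
  proof eventually_elim
    case (elim \<omega>)
    show ?case
    proof (rule tendsto_average_of_geometric_times)
      show "mono (\<lambda>n. \<Sum>k=1..n. Y k \<omega>)" using nn by (intro monoI sum_mono2) auto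
      show "expectation (Y 1) \<ge> 0" using nn by (intro integral_nonneg_AE) auto
    qed (use elim nn in \<open>auto intro: sum_nonneg\<close>)
  qed
qed

section \<open>Products of the noise at different times\<close>

lemma tendsto_average_shift:
  fixes f :: "nat \<Rightarrow> real"
  assumes "(\<lambda>n. (\<Sum>k=1..n. f k) / n) \<longlonglongrightarrow> L"
  shows "(\<lambda>n. (\<Sum>k=1..n. f (k + h)) / n) \<longlonglongrightarrow> L"
proof -
  have "(\<lambda>n. (\<Sum>k=1..n+h. f k) / real (n + h) * (real (n + h) / real n) - (\<Sum>k=1..h. f k) / n) \<longlonglongrightarrow> L * 1 - 0"
  proof (intro tendsto_diff tendsto_mult LIMSEQ_ignore_initial_segment[OF assms])
    have "(\<lambda>n. 1 + real h / real n) \<longlonglongrightarrow> 1 + 0"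
      by (intro tendsto_intros lim_const_over_n)
    moreover have "\<forall>\<^sub>F n in sequentially. 1 + real h / real n = real (n + h) / real n"
      using eventually_gt_at_top[of 0] by eventually_elim (simp add: field_simps)
    ultimately show "(\<lambda>n. real (n + h) / real n) \<longlonglongrightarrow> 1"
      by (simp add: Lim_transform_eventually)
    show "(\<lambda>n. (\<Sum>k=1..h. f k) / real n) \<longlonglongrightarrow> 0" by (rule lim_const_over_n)
  qed
  moreover have "\<forall>\<^sub>F n in sequentially. (\<Sum>k=1..n+h. f k) / real (n + h) * (real (n + h) / real n) - (\<Sum>k=1..h. f k) / n
      = (\<Sum>k=1..n. f (k + h)) / n"
    using eventually_gt_at_top[of 0]
  proof eventually_elim
    case (elim n)
    have "(\<Sum>k=1..n+h. f k) = (\<Sum>k=1..h. f k) + (\<Sum>k=1+h..n+h. f k)"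
      using sum.ub_add_nat[of 1 h f n] by (simp add: add.commute)
    also have "(\<Sum>k=1+h..n+h. f k) = (\<Sum>k=1..n. f (k + h))"
      by (rule sum.shift_bounds_cl_nat_ivl)
    finally have "((\<Sum>k=1..n+h. f k) - (\<Sum>k=1..h. f k)) / n = (\<Sum>k=1..n. f (k + h)) / n" by simp
    moreover have "(\<Sum>k=1..n+h. f k) / real (n + h) * (real (n + h) / real n) = (\<Sum>k=1..n+h. f k) / n"
      using elim by simp
    ultimately show ?case by (simp only: diff_divide_distrib)
  qed
  ultimately show ?thesis by (simp add: Lim_transform_eventually)
qed

text \<open>
  For \<open>k < l\<close> the factor \<open>V\<^sub>l\<^sub>+\<^sub>h\<close> is independent of the others in \<open>V\<^sub>k V\<^sub>k\<^sub>+\<^sub>h V\<^sub>l V\<^sub>l\<^sub>+\<^sub>h\<close>, so the lagged products are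
  orthogonal and their averages vanish along geometric subsequences.  The products change sign, which
  rules out monotone interpolation between these times; it is applied to the sums of
  \<open>(V\<^sub>k + V\<^sub>k\<^sub>+\<^sub>h)\<^sup>2\<close> instead, whose square terms are already known to converge.
\<close>

lemma (in prob_space) average_lagged_products_tendsto_0:
  fixes V :: "nat \<Rightarrow> 'a \<Rightarrow> real"
  assumes ind: "indep_vars (\<lambda>_. borel) V {1..}"
    and int: "\<And>k. k \<ge> 1 \<Longrightarrow> integrable M (\<lambda>\<omega>. (V k \<omega>)\<^sup>2)"
    and mean: "\<And>k. k \<ge> 1 \<Longrightarrow> expectation (V k) = 0"
    and var: "\<And>k. k \<ge> 1 \<Longrightarrow> expectation (\<lambda>\<omega>. (V k \<omega>)\<^sup>2) = s"
    and sq: "AE \<omega> in M. (\<lambda>n. (\<Sum>k=1..n. (V k \<omega>)\<^sup>2) / n) \<longlonglongrightarrow> s"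
    and h: "h \<ge> 1"
  shows "AE \<omega> in M. (\<lambda>n. (\<Sum>k=1..n. V k \<omega> * V (k + h) \<omega>) / n) \<longlonglongrightarrow> 0"
proof -
  have meas: "V k \<in> borel_measurable M" if "k \<ge> 1" for k
    using ind that by (auto simp: indep_vars_def)
  have int1: "integrable M (V k)" if "k \<ge> 1" for k
    using square_integrable_imp_integrable[OF meas[OF that] int[OF that]] .
  define W where "W k \<omega> = (if k \<ge> 1 then V k \<omega> * V (k + h) \<omega> else 0)" for k \<omega>
  have sq_ind: "indep_vars (\<lambda>_. borel) (\<lambda>k \<omega>. (V k \<omega>)\<^sup>2) {1..}"
    by (rule indep_vars_compose2[OF ind]) measurable
  have W2: "integrable M (\<lambda>\<omega>. (W k \<omega>)\<^sup>2)" "expectation (\<lambda>\<omega>. (W k \<omega>)\<^sup>2) = s * s" if "k \<ge> 1" for k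
    using expectation_mult_indep_vars[OF sq_ind, of k "k + h"] int var that h
    by (auto simp: W_def power_mult_distrib)
  have cross: "integrable M (\<lambda>\<omega>. W k \<omega> * W l \<omega>) \<and> expectation (\<lambda>\<omega>. W k \<omega> * W l \<omega>) = 0"
    if k: "1 \<le> k" and kl: "k < l" for k l
  proof -
    \<comment> \<open>the times \<open>k + h\<close> and \<open>l\<close> may coincide; \<open>P i\<close> then squares its argument\<close>
    define P where "P i y = (if i \<in> {k, k + h} then y else 1) * (if i \<in> {l, l + h} then y else 1)"
      for i and y :: real
    let ?I = "{k, k + h, l, l + h}"
    have ind': "indep_vars (\<lambda>_. borel) (\<lambda>i \<omega>. P i (V i \<omega>)) ?I"
      by (rule indep_vars_compose2[OF indep_vars_subset[OF ind]])
         (use k kl in \<open>auto simp: P_def[abs_def]\<close>)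
    have I: "integrable M (\<lambda>\<omega>. P i (V i \<omega>))" if "i \<in> ?I" for i
    proof -
      have "i \<ge> 1" using that k kl by auto
      thus ?thesis using int[of i] int1[of i]
        by (cases "i \<in> {k, k + h}"; cases "i \<in> {l, l + h}") (simp_all add: P_def power2_eq_square)
    qed
    have z: "expectation (\<lambda>\<omega>. P (l + h) (V (l + h) \<omega>)) = 0"
      using mean[of "l + h"] k kl h by (simp add: P_def)
    have prod: "(\<Prod>i\<in>?I. P i (V i \<omega>)) = W k \<omega> * W l \<omega>" for \<omega>
    proof (cases "k + h = l")
      case True
      hence "?I = {k, l, l + h}" by auto
      thus ?thesis using True k kl h by (simp add: P_def W_def)
    next
      case False
      thus ?thesis using k kl h by (simp add: P_def W_def)
    qed
    have "integrable M (\<lambda>\<omega>. \<Prod>i\<in>?I. P i (V i \<omega>))"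
      by (rule indep_vars_integrable[OF _ ind' I]) simp
    moreover have "expectation (\<lambda>\<omega>. \<Prod>i\<in>?I. P i (V i \<omega>)) = (\<Prod>i\<in>?I. expectation (\<lambda>\<omega>. P i (V i \<omega>)))"
      by (rule indep_vars_lebesgue_integral[OF _ ind' I]) simp
    moreover have "(\<Prod>i\<in>?I. expectation (\<lambda>\<omega>. P i (V i \<omega>))) = 0"
      by (rule prod_zero) (use z in auto)
    ultimately show ?thesis unfolding prod by simp
  qed
  have WW: "integrable M (\<lambda>\<omega>. W k \<omega> * W l \<omega>)" for k l
  proof -
    consider "k = 0 \<or> l = 0" | "k \<ge> 1" "k < l" | "l \<ge> 1" "l < k" | "k \<ge> 1" "k = l" by linarith
    thus ?thesis
    proof cases
      case 1
      thus ?thesis by (auto simp: W_def)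
    next
      case 2
      thus ?thesis using cross by blast
    next
      case 3
      hence "integrable M (\<lambda>\<omega>. W l \<omega> * W k \<omega>)" using cross by blast
      thus ?thesis by (simp only: mult.commute)
    next
      case 4
      thus ?thesis using W2(1)[of k] by (simp add: power2_eq_square)
    qed
  qed
  have orth: "expectation (\<lambda>\<omega>. W k \<omega> * W l \<omega>) = 0" if "1 \<le> k" "1 \<le> l" "k \<noteq> l" for k l
  proof (cases "k < l")
    case False
    hence "expectation (\<lambda>\<omega>. W l \<omega> * W k \<omega>) = 0" using cross[of l k] that by auto
    thus ?thesis by (simp only: mult.commute)
  qed (use cross that in blast)
  have geo: "AE \<omega> in M. (\<lambda>n. (\<Sum>k=1..geo q n. W k \<omega>) / geo q n) \<longlonglongrightarrow> 0" if q: "q > 1" for q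
  proof (rule AE_geo_average_tendsto_0[OF q, where W="\<lambda>_. W" and c="\<lambda>_. s * s"])
    show "summable (\<lambda>n. s * s / q ^ n)"
      using summable_mult[OF summable_geometric[of "1 / q"], of "s * s"] q by (simp add: power_divide)
  qed (use WW orth W2 in auto)
  have "AE \<omega> in M. \<forall>m. (\<lambda>n. (\<Sum>k=1..geo (1 + 1 / Suc m) n. W k \<omega>) / geo (1 + 1 / Suc m) n) \<longlonglongrightarrow> 0"
    by (subst AE_all_countable, intro allI geo) auto
  with sq show ?thesis
  proof eventually_elim
    case (elim \<omega>)
    define A where "A n = (\<Sum>k=1..n. (V k \<omega> + V (k + h) \<omega>)\<^sup>2)" for n
    define S where "S n = (\<Sum>k=1..n. (V k \<omega>)\<^sup>2) / n" for n
    define T where "T n = (\<Sum>k=1..n. (V (k + h) \<omega>)\<^sup>2) / n" for n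
    define R where "R n = (\<Sum>k=1..n. V k \<omega> * V (k + h) \<omega>) / n" for n
    have S: "S \<longlonglongrightarrow> s" using elim(1) unfolding S_def .
    have T: "T \<longlonglongrightarrow> s" unfolding T_def
      by (rule tendsto_average_shift[of "\<lambda>k. (V k \<omega>)\<^sup>2", OF elim(1)])
    have Aeq: "A n / n = S n + T n + 2 * R n" for n
      unfolding A_def S_def T_def R_def
      by (simp add: power2_sum sum.distrib sum_distrib_left add_divide_distrib mult.assoc)
    have "(\<lambda>n. A n / n) \<longlonglongrightarrow> s + s + 2 * 0"
    proof (rule tendsto_average_of_geometric_times)
      show "mono A" unfolding A_def by (intro monoI sum_mono2) auto
      show "A n \<ge> 0" for n unfolding A_def by (intro sum_nonneg) auto
      have "s \<ge> 0" using var[of 1] by (simp flip: var[of 1])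
      thus "s + s + 2 * 0 \<ge> 0" by simp
      fix m
      let ?k = "geo (1 + 1 / Suc m)"
      have k: "filterlim ?k at_top sequentially"
      proof -
        have "filterlim (\<lambda>n. (1 + 1 / real (Suc m)) ^ n) at_top sequentially"
          by (rule real_power_at_top) simp
        hence "filterlim (\<lambda>n. real (?k n)) at_top sequentially"
          by (rule filterlim_at_top_mono) (use geo_bounds in \<open>auto intro: always_eventually\<close>)
        thus ?thesis by (simp add: filterlim_sequentially_iff_filterlim_real)
      qed
      have "(\<lambda>n. R (?k n)) \<longlonglongrightarrow> 0"
        using elim(2)[rule_format, of m] unfolding R_def W_def by (simp cong: sum.cong_simp)
      thus "(\<lambda>n. A (?k n) / ?k n) \<longlonglongrightarrow> s + s + 2 * 0" unfolding Aeq
        by (intro tendsto_add tendsto_mult tendsto_const filterlim_compose[OF S k] filterlim_compose[OF T k])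
    qed
    hence "(\<lambda>n. (A n / n - S n - T n) / 2) \<longlonglongrightarrow> (s + s + 2 * 0 - s - s) / 2"
      by (intro tendsto_intros S T) auto
    moreover have "(\<lambda>n. (A n / n - S n - T n) / 2) = R" by (simp add: Aeq fun_eq_iff)
    ultimately show ?case unfolding R_def by simp
  qed
qed

section \<open>Empirical lag covariances of a trajectory\<close>

definition causal :: "(int \<Rightarrow> real) \<Rightarrow> bool" where
  "causal u \<longleftrightarrow> (\<forall>k<0. u k = 0)"

text \<open>
  A negative lag makes \<open>w\<close> be read at negative times, where causal trajectories vanish; the lags are
  integers so that both orders of the two arguments are covered by one function \<open>g\<close>.
\<close>

definition has_lag_cov :: "(int \<Rightarrow> real) \<Rightarrow> (int \<Rightarrow> real) \<Rightarrow> (int \<Rightarrow> real) \<Rightarrow> bool" where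
  "has_lag_cov u w g \<longleftrightarrow>
     (\<forall>h. (\<lambda>n. (\<Sum>k<n. u (int k) * w (int k + h)) / real n) \<longlonglongrightarrow> g h)"

definition power_bounded :: "(int \<Rightarrow> real) \<Rightarrow> bool" where
  "power_bounded u \<longleftrightarrow> (\<exists>B\<ge>0. \<forall>n. (\<Sum>k<n. (u (int k))\<^sup>2) \<le> B * real n)"

lemma average_delay:
  fixes S :: "nat \<Rightarrow> real"
  assumes "(\<lambda>n. S n / real n) \<longlonglongrightarrow> L"
  shows "(\<lambda>n. S (n - i) / real n) \<longlonglongrightarrow> L"
proof (rule LIMSEQ_offset[where k=i])
  have "(\<lambda>n. 1 - real i * inverse (real (n + i))) \<longlonglongrightarrow> 1 - real i * 0"
    by (intro tendsto_intros LIMSEQ_ignore_initial_segment[OF lim_inverse_n])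
  from tendsto_mult[OF assms this]
  have "(\<lambda>n. S n / real n * (1 - real i * inverse (real (n + i)))) \<longlonglongrightarrow> L" by simp
  moreover have "\<forall>\<^sub>F n in sequentially. S n / real n * (1 - real i * inverse (real (n + i))) = S (n + i - i) / real (n + i)"
    using eventually_gt_at_top[of 0] by eventually_elim (simp add: divide_simps)
  ultimately show "(\<lambda>n. S (n + i - i) / real (n + i)) \<longlonglongrightarrow> L"
    by (rule Lim_transform_eventually)
qed

lemma average_advance:
  fixes S :: "nat \<Rightarrow> real"
  assumes "(\<lambda>n. S n / real n) \<longlonglongrightarrow> L"
  shows "(\<lambda>n. S (n + i) / real n) \<longlonglongrightarrow> L"
proof -
  have "(\<lambda>n. 1 + real i * inverse (real n)) \<longlonglongrightarrow> 1 + real i * 0"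
    by (intro tendsto_intros lim_inverse_n)
  from tendsto_mult[OF LIMSEQ_ignore_initial_segment[OF assms, of i] this]
  have "(\<lambda>n. S (n + i) / real (n + i) * (1 + real i * inverse (real n))) \<longlonglongrightarrow> L" by simp
  moreover have "\<forall>\<^sub>F n in sequentially. S (n + i) / real (n + i) * (1 + real i * inverse (real n)) = S (n + i) / real n"
    using eventually_gt_at_top[of 0] by eventually_elim (simp add: divide_simps)
  ultimately show ?thesis by (rule Lim_transform_eventually)
qed

lemma sum_delay:
  fixes u w :: "int \<Rightarrow> real"
  assumes "causal u"
  shows "(\<Sum>k<n. u (int k - int i) * w (int k)) = (\<Sum>k<n - i. u (int k) * w (int k + int i))"
proof -
  have "(\<Sum>k<n. u (int k - int i) * w (int k)) = (\<Sum>k\<in>{i..<n}. u (int k - int i) * w (int k))"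
    using assms by (intro sum.mono_neutral_right) (auto simp: causal_def)
  also have "\<dots> = (\<Sum>k<n - i. u (int k) * w (int k + int i))"
    by (rule sum.reindex_bij_witness[where i="\<lambda>k. k + i" and j="\<lambda>k. k - i"]) (auto simp: of_nat_diff)
  finally show ?thesis .
qed

lemma has_lag_cov_delay:
  assumes "has_lag_cov u w g" "causal u"
  shows "(\<lambda>n. (\<Sum>k<n. u (int k - int i) * w (int k + h)) / real n) \<longlonglongrightarrow> g (h + int i)"
  unfolding sum_delay[OF assms(2), where w="\<lambda>k. w (k + h)"]
  using assms(1) by (intro average_delay) (simp add: has_lag_cov_def add.assoc add.commute[of "int i"])

lemma has_lag_cov_swap:
  assumes "has_lag_cov u w g" "causal u" "causal w"
  shows "has_lag_cov w u (\<lambda>h. g (- h))"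
  unfolding has_lag_cov_def
proof
  fix h
  show "(\<lambda>n. (\<Sum>k<n. w (int k) * u (int k + h)) / real n) \<longlonglongrightarrow> g (- h)"
  proof (cases "h \<ge> 0")
    case True
    have "(\<lambda>n. (\<Sum>k<n. u (int k) * w (int k - h)) / real n) \<longlonglongrightarrow> g (- h)"
      using assms(1) unfolding has_lag_cov_def by (simp add: uminus_add_conv_diff diff_conv_add_uminus del: add_uminus_conv_diff)
    from average_advance[OF this, of "nat h"]
    have "(\<lambda>n. (\<Sum>k<n + nat h. w (int k - h) * u (int k)) / real n) \<longlonglongrightarrow> g (- h)"
      by (simp only: mult.commute)
    thus ?thesis using sum_delay[OF assms(3), where i="nat h" and w=u] True by simp
  next
    case False
    have "(\<lambda>n. (\<Sum>k<n. u (int k - int (nat (- h))) * w (int k + 0)) / real n) \<longlonglongrightarrow> g (0 + int (nat (- h)))"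
      by (rule has_lag_cov_delay[OF assms(1,2)])
    thus ?thesis using False by (simp add: mult.commute)
  qed
qed

lemma has_lag_cov_imp_power_bounded:
  assumes "has_lag_cov u u g"
  shows "power_bounded u"
proof -
  have "(\<lambda>n. (\<Sum>k<n. (u (int k))\<^sup>2) / real n) \<longlonglongrightarrow> g 0"
    using assms unfolding has_lag_cov_def by (auto dest!: spec[of _ 0] simp: power2_eq_square)
  hence "Bseq (\<lambda>n. (\<Sum>k<n. (u (int k))\<^sup>2) / real n)" by (intro convergent_imp_Bseq convergentI)
  then obtain B where B: "B > 0" "\<And>n. norm ((\<Sum>k<n. (u (int k))\<^sup>2) / real n) \<le> B"
    by (auto simp: Bseq_def)
  have "(\<Sum>k<n. (u (int k))\<^sup>2) \<le> B * real n" for n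
    using B(2)[of n] by (cases "n = 0") (auto simp: divide_le_eq)
  thus ?thesis unfolding power_bounded_def using B(1) by (intro exI[of _ B]) auto
qed

lemma sum_squares_shift_le:
  assumes "causal w"
  shows "(\<Sum>k<n. (w (int k + h))\<^sup>2) \<le> (\<Sum>k<n + nat \<bar>h\<bar>. (w (int k))\<^sup>2)"
proof -
  let ?K = "{k. k < n \<and> 0 \<le> int k + h}"
  have "(\<Sum>k<n. (w (int k + h))\<^sup>2) = (\<Sum>k\<in>?K. (w (int k + h))\<^sup>2)"
    using assms by (intro sum.mono_neutral_right) (auto simp: causal_def not_le)
  also have "\<dots> = (\<Sum>k\<in>(\<lambda>k. nat (int k + h)) ` ?K. (w (int k))\<^sup>2)"
    by (subst sum.reindex) (auto simp: inj_on_def)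
  also have "\<dots> \<le> (\<Sum>k<n + nat \<bar>h\<bar>. (w (int k))\<^sup>2)"
    by (intro sum_mono2) auto
  finally show ?thesis .
qed

definition convolve :: "(nat \<Rightarrow> real) \<Rightarrow> (int \<Rightarrow> real) \<Rightarrow> int \<Rightarrow> real" where
  "convolve a u k = (if k < 0 then 0 else \<Sum>i\<le>nat k. a i * u (k - int i))"

lemma causal_convolve: "causal (convolve a u)"
  by (simp add: causal_def convolve_def)

lemma convolve_eq_sum:
  assumes "causal u" "k < n"
  shows "convolve a u (int k) = (\<Sum>i<n. a i * u (int k - int i))"
proof -
  have "(\<Sum>i<n. a i * u (int k - int i)) = (\<Sum>i\<le>k. a i * u (int k - int i))"
    using assms by (intro sum.mono_neutral_right) (auto simp: causal_def)
  thus ?thesis by (simp add: convolve_def)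
qed

text \<open>
  Young's inequality: the root mean square of \<open>a * u\<close> is at most \<open>\<Sum>\<bar>a\<^sub>i\<bar>\<close> times that of \<open>u\<close>.  The
  Cauchy-Schwarz inequality is applied with one factor \<open>\<surd>\<bar>a\<^sub>i\<bar>\<close> split off.
\<close>

lemma power_bounded_convolve:
  assumes "causal u" "power_bounded u" and a: "summable (\<lambda>i. \<bar>a i\<bar>)"
  shows "power_bounded (convolve a u)"
proof -
  obtain B where B: "B \<ge> 0" "\<And>n. (\<Sum>k<n. (u (int k))\<^sup>2) \<le> B * real n"
    using assms(2) unfolding power_bounded_def by blast
  define A where "A = (\<Sum>i. \<bar>a i\<bar>)"
  have A: "(\<Sum>i<n. \<bar>a i\<bar>) \<le> A" for n
    unfolding A_def using sum_le_suminf[OF a, of "{..<n}"] by simp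
  have A0: "A \<ge> 0" using A[of 0] by simp
  have "(\<Sum>k<n. (convolve a u (int k))\<^sup>2) \<le> (A * A * B) * real n" for n
  proof -
    have "(convolve a u (int k))\<^sup>2 \<le> A * (\<Sum>i<n. \<bar>a i\<bar> * (u (int k - int i))\<^sup>2)" if "k < n" for k
    proof -
      have "\<bar>convolve a u (int k)\<bar> \<le> (\<Sum>i<n. sqrt \<bar>a i\<bar> * (sqrt \<bar>a i\<bar> * \<bar>u (int k - int i)\<bar>))"
        unfolding convolve_eq_sum[OF assms(1) that]
        by (rule order.trans[OF sum_abs]) (simp add: abs_mult mult.assoc[symmetric])
      hence "(convolve a u (int k))\<^sup>2 \<le> (\<Sum>i<n. sqrt \<bar>a i\<bar> * (sqrt \<bar>a i\<bar> * \<bar>u (int k - int i)\<bar>))\<^sup>2"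
        by (metis abs_ge_zero power2_abs power_mono)
      also have "\<dots> \<le> (\<Sum>i<n. (sqrt \<bar>a i\<bar>)\<^sup>2) * (\<Sum>i<n. (sqrt \<bar>a i\<bar> * \<bar>u (int k - int i)\<bar>)\<^sup>2)"
        by (rule Cauchy_Schwarz_ineq_sum)
      also have "\<dots> = (\<Sum>i<n. \<bar>a i\<bar>) * (\<Sum>i<n. \<bar>a i\<bar> * (u (int k - int i))\<^sup>2)"
        by (simp add: power_mult_distrib)
      also have "\<dots> \<le> A * (\<Sum>i<n. \<bar>a i\<bar> * (u (int k - int i))\<^sup>2)"
        by (intro mult_right_mono A sum_nonneg) auto
      finally show ?thesis .
    qed
    hence "(\<Sum>k<n. (convolve a u (int k))\<^sup>2) \<le> (\<Sum>k<n. A * (\<Sum>i<n. \<bar>a i\<bar> * (u (int k - int i))\<^sup>2))"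
      by (intro sum_mono) auto
    also have "\<dots> = A * (\<Sum>i<n. \<bar>a i\<bar> * (\<Sum>k<n. (u (int k - int i))\<^sup>2))"
      by (simp add: sum_distrib_left[symmetric]) (subst sum.swap, simp add: sum_distrib_left)
    also have "\<dots> \<le> A * (\<Sum>i<n. \<bar>a i\<bar> * (B * real n))"
    proof (intro mult_left_mono sum_mono A0)
      fix i
      have "(\<Sum>k<n. (u (int k - int i))\<^sup>2) = (\<Sum>k<n - i. (u (int k))\<^sup>2)"
        using sum_delay[OF assms(1), where n=n and i=i and w="\<lambda>k. u (k - int i)"] by (simp add: power2_eq_square)
      also have "\<dots> \<le> B * real (n - i)" by (rule B(2))
      also have "\<dots> \<le> B * real n" using B(1) by (intro mult_left_mono) auto
      finally show "(\<Sum>k<n. (u (int k - int i))\<^sup>2) \<le> B * real n" .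
    qed auto
    also have "\<dots> = A * ((\<Sum>i<n. \<bar>a i\<bar>) * (B * real n))" by (simp add: sum_distrib_right)
    also have "\<dots> \<le> A * (A * (B * real n))"
      using B(1) by (intro mult_left_mono mult_right_mono A A0) auto
    finally show ?thesis by (simp add: mult.assoc)
  qed
  thus ?thesis unfolding power_bounded_def using A0 B(1) by (intro exI[of _ "A * A * B"]) auto
qed

text \<open>
  The average is \<open>\<Sum>\<^sub>i a\<^sub>i C\<^sub>i(n)\<close>, where \<open>C\<^sub>i(n)\<close> averages \<open>u\<^sub>k\<^sub>-\<^sub>i w\<^sub>k\<^sub>+\<^sub>h\<close>.  Each \<open>C\<^sub>i(n)\<close> converges, and the bounds on
  the powers of \<open>u\<close> and \<open>w\<close> control all of them uniformly in \<open>i\<close> and \<open>n\<close>, so that Tannery's theorem allows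
  the limit to be taken term by term.
\<close>

lemma has_lag_cov_convolve:
  assumes cov: "has_lag_cov u w g" and u: "causal u" "power_bounded u"
    and w: "causal w" "power_bounded w" and a: "summable (\<lambda>i. \<bar>a i\<bar>)"
  shows "has_lag_cov (convolve a u) w (\<lambda>h. \<Sum>i. a i * g (h + int i))"
  unfolding has_lag_cov_def
proof
  fix h
  obtain Bu where Bu: "Bu \<ge> 0" "\<And>n. (\<Sum>k<n. (u (int k))\<^sup>2) \<le> Bu * real n"
    using u(2) unfolding power_bounded_def by blast
  obtain Bw where Bw: "Bw \<ge> 0" "\<And>n. (\<Sum>k<n. (w (int k))\<^sup>2) \<le> Bw * real n"
    using w(2) unfolding power_bounded_def by blast
  define C where "C i n = (\<Sum>k<n. u (int k - int i) * w (int k + h)) / real n" for i n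
  define B where "B = Bu + Bw * (1 + real (nat \<bar>h\<bar>))"
  have C: "\<bar>C i n\<bar> \<le> B" for i n
  proof (cases "n = 0")
    case True
    thus ?thesis using Bu(1) Bw(1) by (simp add: C_def B_def)
  next
    case False
    have "\<bar>\<Sum>k<n. u (int k - int i) * w (int k + h)\<bar> \<le> (\<Sum>k<n. (u (int k - int i))\<^sup>2 + (w (int k + h))\<^sup>2)"
    proof (rule order.trans[OF sum_abs sum_mono])
      fix k
      show "\<bar>u (int k - int i) * w (int k + h)\<bar> \<le> (u (int k - int i))\<^sup>2 + (w (int k + h))\<^sup>2"
        using sum_squares_bound[of "\<bar>u (int k - int i)\<bar>" "\<bar>w (int k + h)\<bar>"]
          mult_nonneg_nonneg[OF abs_ge_zero[of "u (int k - int i)"] abs_ge_zero[of "w (int k + h)"]]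
        unfolding abs_mult power2_abs by linarith
    qed
    also have "\<dots> = (\<Sum>k<n - i. (u (int k))\<^sup>2) + (\<Sum>k<n. (w (int k + h))\<^sup>2)"
      using sum_delay[OF u(1), where n=n and i=i and w="\<lambda>k. u (k - int i)"] by (simp add: power2_eq_square sum.distrib)
    also have "\<dots> \<le> Bu * real (n - i) + Bw * real (n + nat \<bar>h\<bar>)"
      by (intro add_mono Bu(2) order.trans[OF sum_squares_shift_le[OF w(1)] Bw(2)])
    also have "\<dots> \<le> Bu * real n + Bw * (real n * (1 + real (nat \<bar>h\<bar>)))"
    proof (intro add_mono mult_left_mono Bu(1) Bw(1))
      have "1 * real (nat \<bar>h\<bar>) \<le> real n * real (nat \<bar>h\<bar>)"
        using False by (intro mult_right_mono) auto
      thus "real (n + nat \<bar>h\<bar>) \<le> real n * (1 + real (nat \<bar>h\<bar>))"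
        unfolding of_nat_add distrib_left by simp
    qed simp
    also have "\<dots> = B * real n" by (simp add: B_def algebra_simps)
    finally show ?thesis using False by (simp add: C_def divide_le_eq)
  qed
  have Clim: "C i \<longlonglongrightarrow> g (h + int i)" for i
    unfolding C_def by (rule has_lag_cov_delay[OF cov u(1)])
  have "(\<lambda>n. \<Sum>i. a i * C i n) \<longlonglongrightarrow> (\<Sum>i. a i * g (h + int i))"
  proof (rule tannerys_theorem[THEN conjunct2, THEN conjunct2])
    show "(\<lambda>n. a i * C i n) \<longlonglongrightarrow> a i * g (h + int i)" for i
      by (intro tendsto_intros Clim)
    show "summable (\<lambda>i. \<bar>a i\<bar> * B)" by (rule summable_mult2[OF a])
    show "\<forall>\<^sub>F (i, n) in sequentially \<times>\<^sub>F sequentially. norm (a i * C i n) \<le> \<bar>a i\<bar> * B"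
      using C by (intro always_eventually) (auto simp: abs_mult intro: mult_left_mono)
  qed simp
  moreover have "(\<Sum>i. a i * C i n) = (\<Sum>k<n. convolve a u (int k) * w (int k + h)) / real n" for n
  proof -
    have "C i n = 0" if "i \<ge> n" for i
      using u(1) that unfolding C_def causal_def by (auto intro!: sum.neutral)
    hence "(\<Sum>i. a i * C i n) = (\<Sum>i<n. a i * C i n)"
      by (intro suminf_finite) auto
    also have "\<dots> = (\<Sum>i<n. \<Sum>k<n. a i * u (int k - int i) * w (int k + h)) / real n"
      by (simp add: C_def sum_divide_distrib sum_distrib_left mult.assoc)
    also have "\<dots> = (\<Sum>k<n. (\<Sum>i<n. a i * u (int k - int i)) * w (int k + h)) / real n"
      by (subst sum.swap) (simp add: sum_distrib_right)
    also have "\<dots> = (\<Sum>k<n. convolve a u (int k) * w (int k + h)) / real n"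
      by (intro arg_cong2[where f="(/)"] sum.cong refl) (simp add: convolve_eq_sum[OF u(1)])
    finally show ?thesis .
  qed
  ultimately show "(\<lambda>n. (\<Sum>k<n. convolve a u (int k) * w (int k + h)) / real n) \<longlonglongrightarrow> (\<Sum>i. a i * g (h + int i))"
    by simp
qed

definition white_cov :: "real \<Rightarrow> int \<Rightarrow> real" where
  "white_cov s h = (if h = 0 then s else 0)"

text \<open>
  The filter is applied to one argument at a time; exchanging the arguments in between lets the same
  one-sided lemma serve twice.  The first limit vanishes for \<open>h > 0\<close> because the output at time \<open>k\<close>
  involves no noise later than \<open>k\<close>.
\<close>

lemma has_lag_cov_filtered_noise:
  assumes cov: "has_lag_cov v v (white_cov s)" and v: "causal v" and a: "summable (\<lambda>i. \<bar>a i\<bar>)"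
  shows "has_lag_cov (convolve a v) v (\<lambda>h. if h \<le> 0 then a (nat (- h)) * s else 0)"
    and "\<exists>g. has_lag_cov (convolve a v) (convolve a v) g"
proof -
  have pv: "power_bounded v" by (rule has_lag_cov_imp_power_bounded[OF cov])
  have "(\<Sum>i. a i * white_cov s (h + int i)) = (if h \<le> 0 then a (nat (- h)) * s else 0)" for h
  proof (cases "h \<le> 0")
    case True
    have "(\<Sum>i. a i * white_cov s (h + int i)) = (\<Sum>i\<in>{nat (- h)}. a i * white_cov s (h + int i))"
      using True by (intro suminf_finite) (auto simp: white_cov_def)
    thus ?thesis using True by (simp add: white_cov_def)
  qed (simp add: white_cov_def)
  thus xv: "has_lag_cov (convolve a v) v (\<lambda>h. if h \<le> 0 then a (nat (- h)) * s else 0)"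
    using has_lag_cov_convolve[OF cov v pv v pv a] by simp
  show "\<exists>g. has_lag_cov (convolve a v) (convolve a v) g"
    using has_lag_cov_convolve[OF has_lag_cov_swap[OF xv causal_convolve v] v pv causal_convolve
            power_bounded_convolve[OF v pv a] a] by blast
qed

lemma has_lag_cov_unique:
  assumes "has_lag_cov u w g" "has_lag_cov u w g'"
  shows "g = g'"
  using assms unfolding has_lag_cov_def by (blast intro: ext LIMSEQ_unique)

lemma has_lag_cov_even:
  assumes "has_lag_cov x x g" "causal x"
  shows "g (- h) = g h"
  using has_lag_cov_unique[OF has_lag_cov_swap[OF assms assms(2)] assms(1)] by metis

text \<open>
  The coefficients may depend on \<open>n\<close>, because the residuals at stage \<open>n\<close> are formed with the estimate
  obtained at stage \<open>n\<close>.
\<close>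

lemma has_lag_cov_combination:
  assumes cov: "has_lag_cov u w g" and u: "causal u"
    and c: "\<And>i. i < l \<Longrightarrow> c i \<longlonglongrightarrow> c' i" and d: "\<And>j. j < m \<Longrightarrow> d j \<longlonglongrightarrow> d' j"
  shows "(\<lambda>n. (\<Sum>k<n. (\<Sum>i<l. c i n * u (int k - int i)) * (\<Sum>j<m. d j n * w (int k + h - int j))) / real n)
     \<longlonglongrightarrow> (\<Sum>i<l. \<Sum>j<m. c' i * d' j * g (h + int i - int j))"
proof -
  have "(\<lambda>n. \<Sum>i<l. \<Sum>j<m. c i n * d j n * ((\<Sum>k<n. u (int k - int i) * w (int k + (h - int j))) / real n))
     \<longlonglongrightarrow> (\<Sum>i<l. \<Sum>j<m. c' i * d' j * g (h - int j + int i))"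
    by (intro tendsto_sum tendsto_mult has_lag_cov_delay[OF cov u] c d) auto
  moreover have "(\<Sum>i<l. \<Sum>j<m. c i n * d j n * ((\<Sum>k<n. u (int k - int i) * w (int k + (h - int j))) / real n))
     = (\<Sum>k<n. (\<Sum>i<l. c i n * u (int k - int i)) * (\<Sum>j<m. d j n * w (int k + h - int j))) / real n" for n
  proof -
    have "(\<Sum>i<l. \<Sum>j<m. c i n * d j n * ((\<Sum>k<n. u (int k - int i) * w (int k + (h - int j))) / real n))
      = (\<Sum>i<l. \<Sum>j<m. \<Sum>k<n. (c i n * u (int k - int i)) * (d j n * w (int k + h - int j))) / real n"
      by (simp add: sum_divide_distrib sum_distrib_left algebra_simps)
    also have "(\<Sum>i<l. \<Sum>j<m. \<Sum>k<n. (c i n * u (int k - int i)) * (d j n * w (int k + h - int j)))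
       = (\<Sum>i<l. \<Sum>k<n. \<Sum>j<m. (c i n * u (int k - int i)) * (d j n * w (int k + h - int j)))"
      by (intro sum.cong refl sum.swap)
    also have "\<dots> = (\<Sum>k<n. \<Sum>i<l. \<Sum>j<m. (c i n * u (int k - int i)) * (d j n * w (int k + h - int j)))"
      by (rule sum.swap)
    finally show ?thesis by (simp add: sum_product)
  qed
  ultimately show ?thesis by (simp add: algebra_simps)
qed

text \<open>
  Let \<open>l\<close> be the first index with \<open>u\<^sub>l \<noteq> 0\<close> and \<open>y\<^sub>k = \<Sum>\<^sub>i u\<^sub>i x\<^sub>k\<^sub>-\<^sub>i\<close>.  The noise value \<open>v\<^sub>k\<^sub>-\<^sub>l\<close> is uncorrelated with
  the older outputs \<open>x\<^sub>k\<^sub>-\<^sub>i\<close>, \<open>i > l\<close>, and has covariance \<open>s\<close> with \<open>x\<^sub>k\<^sub>-\<^sub>l\<close>, hence \<open>u\<^sub>l s\<close> with \<open>y\<^sub>k\<close>.  Averaging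
  \<open>(y\<^sub>k - u\<^sub>l v\<^sub>k\<^sub>-\<^sub>l)\<^sup>2 \<ge> 0\<close> bounds the quadratic form below by \<open>u\<^sub>l\<^sup>2 s > 0\<close>.
\<close>

lemma lag_cov_pos_def:
  assumes xx: "has_lag_cov x x \<gamma>" and vv: "has_lag_cov v v (white_cov s)"
    and xv: "has_lag_cov x v (\<lambda>h. if h \<le> 0 then a (nat (- h)) * s else 0)"
    and x: "causal x" and v: "causal v" and a0: "a 0 = 1" and s: "s > 0"
    and nz: "\<exists>i<m. u i \<noteq> 0"
  shows "(\<Sum>i<m. \<Sum>j<m. u i * u j * \<gamma> (int i - int j)) > 0"
proof -
  define l where "l = (LEAST i. u i \<noteq> 0)"
  have l: "u l \<noteq> 0" and least: "\<And>i. i < l \<Longrightarrow> u i = 0"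
    using nz unfolding l_def by (metis (mono_tags, lifting) LeastI, meson not_less_Least)
  have lm: "l < m" using nz least by (metis linorder_neqE_nat order.strict_trans)
  define Q where "Q = (\<Sum>i<m. \<Sum>j<m. u i * u j * \<gamma> (int i - int j))"
  let ?y = "\<lambda>k. \<Sum>i<m. u i * x (int k - int i)"
  have 1: "(\<lambda>n. (\<Sum>k<n. ?y k * ?y k) / real n) \<longlonglongrightarrow> Q"
    using has_lag_cov_combination[OF xx x, where c="\<lambda>i _. u i" and d="\<lambda>i _. u i" and h=0] 
    unfolding Q_def by simp
  have term0: "u i * (if - int l + int i \<le> 0 then a (nat (- (- int l + int i))) * s else 0) = 0"
    if "i \<noteq> l" for i using least that by (cases "i < l") auto
  have "(\<lambda>n. \<Sum>i<m. u i * ((\<Sum>k<n. x (int k - int i) * v (int k + (- int l))) / real n))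
     \<longlonglongrightarrow> (\<Sum>i<m. u i * (if - int l + int i \<le> 0 then a (nat (- (- int l + int i))) * s else 0))"
    by (intro tendsto_sum tendsto_mult tendsto_const has_lag_cov_delay[OF xv x])
  moreover have "(\<Sum>i<m. u i * (if - int l + int i \<le> 0 then a (nat (- (- int l + int i))) * s else 0)) 
     = (\<Sum>i\<in>{l}. u i * (if - int l + int i \<le> 0 then a (nat (- (- int l + int i))) * s else 0))"
    using lm term0 by (intro sum.mono_neutral_right ballI) blast+
  moreover have "(\<Sum>i<m. u i * ((\<Sum>k<n. x (int k - int i) * v (int k + (- int l))) / real n))
     = (\<Sum>k<n. ?y k * v (int k - int l)) / real n" for n
    by (simp add: sum_divide_distrib sum_distrib_left sum_distrib_right mult.assoc) (rule sum.swap)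
  ultimately have 2: "(\<lambda>n. (\<Sum>k<n. ?y k * v (int k - int l)) / real n) \<longlonglongrightarrow> u l * s"
    using a0 by simp
  have 3: "(\<lambda>n. (\<Sum>k<n. v (int k - int l) * v (int k - int l)) / real n) \<longlonglongrightarrow> s"
    using has_lag_cov_delay[OF vv v, of l "- int l"] by (simp add: white_cov_def)
  have "(\<lambda>n. (\<Sum>k<n. ?y k * ?y k) / real n - 2 * u l * ((\<Sum>k<n. ?y k * v (int k - int l)) / real n)
      + u l * u l * ((\<Sum>k<n. v (int k - int l) * v (int k - int l)) / real n))
     \<longlonglongrightarrow> Q - 2 * u l * (u l * s) + u l * u l * s"
    by (intro tendsto_intros 1 2 3)
  moreover have "(\<Sum>k<n. ?y k * ?y k) / real n - 2 * u l * ((\<Sum>k<n. ?y k * v (int k - int l)) / real n)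
      + u l * u l * ((\<Sum>k<n. v (int k - int l) * v (int k - int l)) / real n) \<ge> 0" for n
  proof -
    have "(\<Sum>k<n. ?y k * ?y k) - 2 * u l * (\<Sum>k<n. ?y k * v (int k - int l))
      + u l * u l * (\<Sum>k<n. v (int k - int l) * v (int k - int l))
      = (\<Sum>k<n. ?y k * ?y k - 2 * u l * (?y k * v (int k - int l)) + u l * u l * (v (int k - int l) * v (int k - int l)))"
      by (simp only: sum.distrib sum_subtractf sum_distrib_left)
    also have "\<dots> = (\<Sum>k<n. (?y k - u l * v (int k - int l))\<^sup>2)"
      by (intro sum.cong refl) (simp add: power2_eq_square algebra_simps)
    also have "\<dots> \<ge> 0" by (intro sum_nonneg) auto
    finally have "0 \<le> ((\<Sum>k<n. ?y k * ?y k) - 2 * u l * (\<Sum>k<n. ?y k * v (int k - int l))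
      + u l * u l * (\<Sum>k<n. v (int k - int l) * v (int k - int l))) / real n" by simp
    thus ?thesis by (simp only: add_divide_distrib diff_divide_distrib times_divide_eq_right)
  qed
  ultimately have "0 \<le> Q - 2 * u l * (u l * s) + u l * u l * s"
    by (intro LIMSEQ_le_const) auto
  moreover have "u l * u l * s > 0" using l s by (metis mult_pos_pos not_real_square_gt_zero)
  ultimately show ?thesis unfolding Q_def[symmetric] by (simp add: algebra_simps)
qed

section \<open>Yule-Walker and normal equations\<close>

text \<open>
  The recursion at time \<open>k + h\<close> is multiplied by \<open>x\<^sub>k\<close> and averaged; the noise term drops out for
  \<open>h \<ge> 1\<close>.
\<close>

lemma yule_walker:
  assumes xx: "has_lag_cov x x \<gamma>"
    and xv: "has_lag_cov x v (\<lambda>h. if h \<le> 0 then a (nat (- h)) * s else 0)"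
    and rec: "\<And>k. k \<ge> 0 \<Longrightarrow> x k = (\<Sum>i<p. \<theta> i * x (k - 1 - int i))
        + \<rho> * (x (k - 1) - (\<Sum>i<p. \<theta> i * x (k - 2 - int i))) + v k"
    and h: "h \<ge> 1"
  shows "\<gamma> h = (\<Sum>i<p. \<theta> i * \<gamma> (h - 1 - int i))
        + \<rho> * (\<gamma> (h - 1) - (\<Sum>i<p. \<theta> i * \<gamma> (h - 2 - int i)))"
proof -
  define C where "C w r n = (\<Sum>k<n. x (int k) * w (int k + r)) / real n" for w and r :: int and n
  have Cx: "C x r \<longlonglongrightarrow> \<gamma> r" for r using xx unfolding has_lag_cov_def C_def by blast
  have Cv: "C v h \<longlonglongrightarrow> 0"
    using xv[unfolded has_lag_cov_def, rule_format, of h] h unfolding C_def by simp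
  have lim: "(\<lambda>n. (\<Sum>i<p. \<theta> i * C x (h - 1 - int i) n) + \<rho> * (C x (h - 1) n - (\<Sum>i<p. \<theta> i * C x (h - 2 - int i) n)) + C v h n)
     \<longlonglongrightarrow> (\<Sum>i<p. \<theta> i * \<gamma> (h - 1 - int i)) + \<rho> * (\<gamma> (h - 1) - (\<Sum>i<p. \<theta> i * \<gamma> (h - 2 - int i))) + 0"
    by (intro tendsto_intros Cx Cv)
  have lin: "(\<Sum>i<p. \<theta> i * C x (r - int i) n) = (\<Sum>k<n. x (int k) * (\<Sum>i<p. \<theta> i * x (int k + r - int i))) / real n" for r n
  proof -
    have "(\<Sum>i<p. \<theta> i * C x (r - int i) n) = (\<Sum>i<p. \<Sum>k<n. x (int k) * (\<theta> i * x (int k + r - int i))) / real n"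
      by (simp add: C_def sum_divide_distrib sum_distrib_left algebra_simps)
    also have "(\<Sum>i<p. \<Sum>k<n. x (int k) * (\<theta> i * x (int k + r - int i))) = (\<Sum>k<n. \<Sum>i<p. x (int k) * (\<theta> i * x (int k + r - int i)))"
      by (rule sum.swap)
    finally show ?thesis by (simp add: sum_distrib_left)
  qed
  have "C x h n = (\<Sum>i<p. \<theta> i * C x (h - 1 - int i) n) + \<rho> * (C x (h - 1) n - (\<Sum>i<p. \<theta> i * C x (h - 2 - int i) n)) + C v h n" for n
  proof -
    have "(\<Sum>k<n. x (int k) * x (int k + h)) = (\<Sum>k<n. x (int k) * (\<Sum>i<p. \<theta> i * x (int k + (h - 1) - int i))
        + \<rho> * (x (int k) * x (int k + (h - 1)) - x (int k) * (\<Sum>i<p. \<theta> i * x (int k + (h - 2) - int i)))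
        + x (int k) * v (int k + h))"
    proof (intro sum.cong refl)
      fix k
      have "x (int k + h) = (\<Sum>i<p. \<theta> i * x (int k + (h - 1) - int i))
        + \<rho> * (x (int k + (h - 1)) - (\<Sum>i<p. \<theta> i * x (int k + (h - 2) - int i))) + v (int k + h)"
        using rec[of "int k + h"] h by (simp add: add_diff_eq)
      thus "x (int k) * x (int k + h) = x (int k) * (\<Sum>i<p. \<theta> i * x (int k + (h - 1) - int i))
        + \<rho> * (x (int k) * x (int k + (h - 1)) - x (int k) * (\<Sum>i<p. \<theta> i * x (int k + (h - 2) - int i)))
        + x (int k) * v (int k + h)"
        by (simp only:) (simp only: algebra_simps)
    qed
    thus ?thesis unfolding lin
      by (simp only: C_def sum.distrib sum_subtractf sum_distrib_left[symmetric]) (simp only: add_divide_distrib diff_divide_distrib times_divide_eq_right[symmetric])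
  qed
  hence "C x h \<longlonglongrightarrow> (\<Sum>i<p. \<theta> i * \<gamma> (h - 1 - int i)) + \<rho> * (\<gamma> (h - 1) - (\<Sum>i<p. \<theta> i * \<gamma> (h - 2 - int i))) + 0"
    using lim by presburger
  from LIMSEQ_unique[OF Cx[of h] this] show ?thesis by simp
qed

text \<open>
  Expanding \<open>(1 - \<Sum>\<^sub>i \<theta>\<^sub>i L\<^sup>i)(1 - \<rho>L)\<close> gives the autoregression of order \<open>p + 1\<close> with coefficients
  \<open>\<beta>\<close> followed by \<open>-\<theta>\<^sub>p\<rho>\<close>.
\<close>

lemma sum_ar_coefficients:
  fixes f \<theta> :: "nat \<Rightarrow> real"
  assumes "p \<ge> 1" and b: "\<And>i. i < p \<Longrightarrow> b i = (if i = 0 then \<theta> 0 + \<rho> else \<theta> i - \<theta> (i - 1) * \<rho>)"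
  shows "(\<Sum>i<p. b i * f i) - \<theta> (p - 1) * \<rho> * f p
     = (\<Sum>i<p. \<theta> i * f i) + \<rho> * (f 0 - (\<Sum>i<p. \<theta> i * f (Suc i)))"
proof -
  obtain m where p: "p = Suc m" using assms(1) by (cases p) auto
  have "(\<Sum>i<p. b i * f i) = (\<theta> 0 + \<rho>) * f 0 + (\<Sum>i<m. (\<theta> (Suc i) - \<theta> i * \<rho>) * f (Suc i))"
    unfolding p by (subst sum.lessThan_Suc_shift) (simp add: b p)
  also have "\<dots> = (\<Sum>i<p. \<theta> i * f i) + \<rho> * f 0 - \<rho> * (\<Sum>i<m. \<theta> i * f (Suc i))"
    unfolding p sum.lessThan_Suc_shift[of "\<lambda>i. \<theta> i * f i"]
    by (simp add: algebra_simps sum_subtractf sum_distrib_left)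
  finally show ?thesis unfolding p by (simp add: algebra_simps)
qed

text \<open>
  The coefficients of the one-step prediction error \<open>x\<^sub>k - \<Sum>\<^sub>i t\<^sub>i x\<^sub>k\<^sub>-\<^sub>1\<^sub>-\<^sub>i\<close> in terms of \<open>x\<^sub>k, x\<^sub>k\<^sub>-\<^sub>1, \<dots>\<close>.
\<close>

definition residual_coeff :: "(nat \<Rightarrow> real) \<Rightarrow> nat \<Rightarrow> real" where
  "residual_coeff t i = (if i = 0 then 1 else - t (i - 1))"

text \<open>
  In what follows \<open>b\<close> and \<open>-c\<close> are the autoregression coefficients of order \<open>p + 1\<close>, and \<open>t\<close> solves
  \<open>(I + cJ) t = b\<close>; for \<open>b = \<beta>\<close> and \<open>c = \<theta>\<^sub>p\<rho>\<close> the solution is \<open>\<theta>\<^sup>*\<close>.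
\<close>

context
  fixes \<gamma> :: "int \<Rightarrow> real" and b t :: "nat \<Rightarrow> real" and c :: real and p :: nat
  assumes even: "\<And>h. \<gamma> (- h) = \<gamma> h"
    and c: "\<bar>c\<bar> < 1"
    and t: "\<And>i. i < p \<Longrightarrow> t i + c * t (p - 1 - i) = b i"
    and yw: "\<And>h. 1 \<le> h \<Longrightarrow> \<gamma> h = (\<Sum>i<p. b i * \<gamma> (h - 1 - int i)) - c * \<gamma> (h - 1 - int p)"
begin

lemma sum_reversed_toeplitz:
  "(\<Sum>j<p. t (p - 1 - j) * \<gamma> (i - int j)) = (\<Sum>j<p. t j * \<gamma> (int p - 1 - i - int j))"
proof (rule sum.reindex_bij_witness[where i="\<lambda>j. p - 1 - j" and j="\<lambda>j. p - 1 - j"])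
  fix j assume "j \<in> {..<p}"
  hence "int p - 1 - i - int (p - 1 - j) = - (i - int j)" by (auto simp: of_nat_diff)
  thus "t (p - 1 - j) * \<gamma> (int p - 1 - i - int (p - 1 - j)) = t (p - 1 - j) * \<gamma> (i - int j)"
    by (simp only: even)
qed auto

text \<open>
  Substituting \<open>b = (I + cJ) t\<close> into the Yule-Walker equation turns the defect of the \<open>i\<close>-th normal
  equation into \<open>-c\<close> times the defect of its mirror image.
\<close>

lemma prediction_defect_reflection:
  assumes "0 \<le> i"
  shows "\<gamma> (i + 1) - (\<Sum>j<p. t j * \<gamma> (i - int j))
    = - c * (\<gamma> (int p - i) - (\<Sum>j<p. t j * \<gamma> (int p - 1 - i - int j)))"
proof -
  have "\<gamma> (i + 1) = (\<Sum>j<p. (t j + c * t (p - 1 - j)) * \<gamma> (i - int j)) - c * \<gamma> (i - int p)"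
    using yw[of "i + 1"] t assms by simp
  also have "(\<Sum>j<p. (t j + c * t (p - 1 - j)) * \<gamma> (i - int j))
     = (\<Sum>j<p. t j * \<gamma> (i - int j)) + c * (\<Sum>j<p. t (p - 1 - j) * \<gamma> (i - int j))"
    by (simp add: algebra_simps sum.distrib sum_distrib_left)
  also have "\<gamma> (i - int p) = \<gamma> (int p - i)" using even[of "int p - i"] by simp
  finally show ?thesis unfolding sum_reversed_toeplitz by (simp add: algebra_simps)
qed

text \<open>
  Reflecting twice multiplies each defect by \<open>c\<^sup>2 < 1\<close>, so the defects vanish.
\<close>

lemma normal_equations:
  assumes "0 \<le> i" "i < int p"
  shows "(\<Sum>j<p. t j * \<gamma> (i - int j)) = \<gamma> (i + 1)"
proof -
  define D where "D i = \<gamma> (i + 1) - (\<Sum>j<p. t j * \<gamma> (i - int j))" for i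
  have 1: "D i = - c * D (int p - 1 - i)"
    using prediction_defect_reflection[of i] assms by (simp add: D_def)
  have 2: "D (int p - 1 - i) = - c * D i"
    using prediction_defect_reflection[of "int p - 1 - i"] assms by (simp add: D_def add.commute)
  have "D i = c\<^sup>2 * D i" using 1[unfolded 2] by (simp add: power2_eq_square)
  moreover have "c\<^sup>2 < 1" using c by (simp add: abs_square_less_1)
  ultimately have "D i = 0" by (metis less_irrefl mult_cancel_right1)
  thus ?thesis unfolding D_def by simp
qed

lemma residual_lag_cov:
  "(\<Sum>i<Suc p. \<Sum>j<Suc p. residual_coeff t i * residual_coeff t j * \<gamma> (h + int i - int j))
    = (\<Sum>i<Suc p. residual_coeff t i * (\<gamma> (h + int i) - (\<Sum>j<p. t j * \<gamma> (h + int i - 1 - int j))))"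
proof (rule sum.cong[OF refl])
  fix i
  have "(\<Sum>j<Suc p. residual_coeff t i * residual_coeff t j * \<gamma> (h + int i - int j))
    = residual_coeff t i * (\<Sum>j<Suc p. residual_coeff t j * \<gamma> (h + int i - int j))"
    by (simp only: sum_distrib_left mult.assoc)
  also have "(\<Sum>j<Suc p. residual_coeff t j * \<gamma> (h + int i - int j))
    = \<gamma> (h + int i) - (\<Sum>j<p. t j * \<gamma> (h + int i - 1 - int j))"
    by (subst sum.lessThan_Suc_shift) (simp add: residual_coeff_def sum_negf algebra_simps)
  finally show "(\<Sum>j<Suc p. residual_coeff t i * residual_coeff t j * \<gamma> (h + int i - int j))
    = residual_coeff t i * (\<gamma> (h + int i) - (\<Sum>j<p. t j * \<gamma> (h + int i - 1 - int j)))" .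
qed

lemma residual_variance:
  "(\<Sum>i<Suc p. \<Sum>j<Suc p. residual_coeff t i * residual_coeff t j * \<gamma> (int i - int j))
    = \<gamma> 0 - (\<Sum>j<p. t j * \<gamma> (int j + 1))"
proof -
  have e: "\<gamma> (- 1 - int j) = \<gamma> (int j + 1)" for j
    using even[of "int j + 1"] by (simp add: algebra_simps)
  have "(\<Sum>i<Suc p. residual_coeff t i * (\<gamma> (int i) - (\<Sum>j<p. t j * \<gamma> (int i - 1 - int j))))
     = \<gamma> 0 - (\<Sum>j<p. t j * \<gamma> (- 1 - int j)) +
       (\<Sum>i<p. residual_coeff t (Suc i) * (\<gamma> (int i + 1) - (\<Sum>j<p. t j * \<gamma> (int i - int j))))"
    by (subst sum.lessThan_Suc_shift) (simp add: residual_coeff_def add.commute)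
  also have "(\<Sum>i<p. residual_coeff t (Suc i) * (\<gamma> (int i + 1) - (\<Sum>j<p. t j * \<gamma> (int i - int j)))) = 0"
    by (intro sum.neutral) (simp add: normal_equations)
  finally show ?thesis using residual_lag_cov[of 0] by (simp add: e)
qed

text \<open>
  By the normal equations the prediction error is uncorrelated with the previous \<open>p\<close> values, so only
  the covariance with the value \<open>p + 1\<close> steps back contributes; by reflection it is \<open>-c\<close> times the
  variance of the prediction error.
\<close>

lemma residual_lag_one_covariance:
  assumes "p \<ge> 1"
  shows "(\<Sum>i<Suc p. \<Sum>j<Suc p. residual_coeff t i * residual_coeff t j * \<gamma> (1 + int i - int j))
    = c * t (p - 1) * (\<gamma> 0 - (\<Sum>j<p. t j * \<gamma> (int j + 1)))"
proof -
  have e: "\<gamma> (- 1 - int j) = \<gamma> (int j + 1)" for j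
    using even[of "int j + 1"] by (simp add: algebra_simps)
  have "(\<Sum>i<Suc p. residual_coeff t i * (\<gamma> (1 + int i) - (\<Sum>j<p. t j * \<gamma> (1 + int i - 1 - int j))))
     = (\<Sum>i<p. residual_coeff t i * (\<gamma> (int i + 1) - (\<Sum>j<p. t j * \<gamma> (int i - int j))))
       + residual_coeff t p * (\<gamma> (int p + 1) - (\<Sum>j<p. t j * \<gamma> (int p - int j)))"
    by (simp add: add.commute)
  also have "(\<Sum>i<p. residual_coeff t i * (\<gamma> (int i + 1) - (\<Sum>j<p. t j * \<gamma> (int i - int j)))) = 0"
    by (intro sum.neutral) (simp add: normal_equations)
  also have "\<gamma> (int p + 1) - (\<Sum>j<p. t j * \<gamma> (int p - int j))
     = - c * (\<gamma> 0 - (\<Sum>j<p. t j * \<gamma> (int j + 1)))"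
    using prediction_defect_reflection[of "int p"] by (simp add: e)
  finally show ?thesis using residual_lag_cov[of 1] assms by (simp add: residual_coeff_def)
qed

end

section \<open>Continuity of the solution of a linear system\<close>

lemma tendsto_det:
  fixes A :: "nat \<Rightarrow> real mat"
  assumes "\<And>n. A n \<in> carrier_mat p p" "B \<in> carrier_mat p p"
    and "\<And>i j. i < p \<Longrightarrow> j < p \<Longrightarrow> (\<lambda>n. A n $$ (i, j)) \<longlonglongrightarrow> B $$ (i, j)"
  shows "(\<lambda>n. det (A n)) \<longlonglongrightarrow> det B"
proof -
  have "(\<lambda>n. \<Sum>q\<in>{q. q permutes {0..<p}}. signof q * (\<Prod>i = 0..<p. A n $$ (i, q i)))
    \<longlonglongrightarrow> (\<Sum>q\<in>{q. q permutes {0..<p}}. signof q * (\<Prod>i = 0..<p. B $$ (i, q i)))"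
  proof (intro tendsto_sum tendsto_mult tendsto_const tendsto_prod assms)
    fix q i assume "q \<in> {q. q permutes {0..<p}}" "i \<in> {0..<p}"
    thus "q i < p" "i < p" using permutes_in_image[of q "{0..<p}" i] by auto
  qed
  thus ?thesis by (simp add: det_def'[OF assms(1)] det_def'[OF assms(2)])
qed

lemma tendsto_adj_mat:
  fixes A :: "nat \<Rightarrow> real mat"
  assumes A: "\<And>n. A n \<in> carrier_mat p p" and B: "B \<in> carrier_mat p p"
    and lim: "\<And>i j. i < p \<Longrightarrow> j < p \<Longrightarrow> (\<lambda>n. A n $$ (i, j)) \<longlonglongrightarrow> B $$ (i, j)"
    and ij: "i < p" "j < p"
  shows "(\<lambda>n. adj_mat (A n) $$ (i, j)) \<longlonglongrightarrow> adj_mat B $$ (i, j)"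
proof -
  have dimA: "dim_row (A n) = p" "dim_col (A n) = p" for n using A[of n] by auto
  have dimB: "dim_row B = p" "dim_col B = p" using B by auto
  have "(\<lambda>n. det (mat_delete (A n) j i)) \<longlonglongrightarrow> det (mat_delete B j i)"
  proof (rule tendsto_det[where p="p - 1"])
    fix r c assume rc: "r < p - 1" "c < p - 1"
    define r' where "r' = (if r < j then r else Suc r)"
    define c' where "c' = (if c < i then c else Suc c)"
    have rc': "r' < p" "c' < p" using rc by (auto simp: r'_def c'_def)
    have "mat_delete C j i $$ (r, c) = C $$ (r', c')" if "C \<in> carrier_mat p p" for C :: "real mat"
      using that rc by (simp add: mat_delete_def r'_def c'_def)
    thus "(\<lambda>n. mat_delete (A n) j i $$ (r, c)) \<longlonglongrightarrow> mat_delete B j i $$ (r, c)"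
      using lim[OF rc'] A B by presburger
  qed (use dimA dimB in \<open>auto simp: mat_delete_def\<close>)
  thus ?thesis using ij
    by (simp add: adj_mat_def dimA dimB cofactor_def)
qed

lemma mat_inverse_solves:
  fixes A :: "'a :: field mat"
  assumes A: "A \<in> carrier_mat p p" and d: "det A \<noteq> 0" and b: "b \<in> carrier_vec p"
  shows "the (mat_inverse A) *\<^sub>v b \<in> carrier_vec p"
    and "A *\<^sub>v (the (mat_inverse A) *\<^sub>v b) = b"
proof -
  have "mat_inverse A \<noteq> None"
  proof
    assume n: "mat_inverse A = None"
    have "A \<in> Units (ring_mat TYPE('a) p ())" using det_non_zero_imp_unit[OF A d] .
    with mat_inverse(1)[OF A n, where b="()"] show False by blast
  qed
  then obtain C where C: "mat_inverse A = Some C" by auto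
  have C': "A * C = 1\<^sub>m p" "C \<in> carrier_mat p p" using mat_inverse(2)[OF A C] by auto
  show "the (mat_inverse A) *\<^sub>v b \<in> carrier_vec p" using C C'(2) b by simp
  show "A *\<^sub>v (the (mat_inverse A) *\<^sub>v b) = b"
    using C C' A b by (simp flip: assoc_mult_mat_vec[OF A C'(2) b])
qed

lemma cramer:
  fixes A :: "'a :: comm_ring_1 mat"
  assumes A: "A \<in> carrier_mat p p" and y: "y \<in> carrier_vec p" and i: "i < p"
  shows "(\<Sum>j<p. adj_mat A $$ (i, j) * (A *\<^sub>v y) $ j) = det A * y $ i"
proof -
  have adj: "adj_mat A \<in> carrier_mat p p" "adj_mat A * A = det A \<cdot>\<^sub>m 1\<^sub>m p"
    using adj_mat[OF A] by auto
  have "(\<Sum>j<p. adj_mat A $$ (i, j) * (A *\<^sub>v y) $ j) = (adj_mat A *\<^sub>v (A *\<^sub>v y)) $ i"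
    using adj(1) A y i by (simp add: scalar_prod_def lessThan_atLeast0)
  also have "adj_mat A *\<^sub>v (A *\<^sub>v y) = (det A \<cdot>\<^sub>m 1\<^sub>m p) *\<^sub>v y"
    unfolding adj(2)[symmetric] by (rule assoc_mult_mat_vec[OF adj(1) A y, symmetric])
  also have "\<dots> $ i = (\<Sum>j<p. det A * (if i = j then y $ j else 0))"
    using y i by (auto simp: scalar_prod_def lessThan_atLeast0 intro!: sum.cong)
  also have "\<dots> = det A * y $ i"
    using i by (simp flip: sum_distrib_left)
  finally show ?thesis .
qed

text \<open>
  Cramer's rule expresses the solution through determinants, which are polynomials in the entries.  The
  system is normalised by \<open>1/n\<close> on both sides, which leaves its solution unchanged; invertibility
  for large \<open>n\<close> follows from that of the limit.
\<close>

lemma tendsto_linear_solution: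
  fixes A :: "nat \<Rightarrow> real mat" and b :: "nat \<Rightarrow> real vec" and r :: "nat \<Rightarrow> real"
  assumes A: "\<And>n. A n \<in> carrier_mat p p" and b: "\<And>n. b n \<in> carrier_vec p"
    and \<Gamma>: "\<Gamma> \<in> carrier_mat p p" and t: "t \<in> carrier_vec p" and d: "det \<Gamma> \<noteq> 0"
    and limA: "\<And>i j. i < p \<Longrightarrow> j < p \<Longrightarrow> (\<lambda>n. A n $$ (i, j) / real n) \<longlonglongrightarrow> \<Gamma> $$ (i, j)"
    and limb: "\<And>i. i < p \<Longrightarrow> (\<lambda>n. b n $ i / real n) \<longlonglongrightarrow> (\<Gamma> *\<^sub>v t) $ i"
    and i: "i < p"
  shows "(\<lambda>n. (the (mat_inverse (A n)) *\<^sub>v b n) $ i) \<longlonglongrightarrow> t $ i"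
proof -
  define A' where "A' n = (1 / real n) \<cdot>\<^sub>m A n" for n
  define b' where "b' n = (1 / real n) \<cdot>\<^sub>v b n" for n
  have A': "A' n \<in> carrier_mat p p" for n using A unfolding A'_def by simp
  have b': "b' n \<in> carrier_vec p" for n using b unfolding b'_def by simp
  have lA: "(\<lambda>n. A' n $$ (i, j)) \<longlonglongrightarrow> \<Gamma> $$ (i, j)" if "i < p" "j < p" for i j
  proof -
    have "A' n $$ (i, j) = A n $$ (i, j) / real n" for n using A[of n] that by (simp add: A'_def)
    thus ?thesis using limA[OF that] by simp
  qed
  have lb: "(\<lambda>n. b' n $ i) \<longlonglongrightarrow> (\<Gamma> *\<^sub>v t) $ i" if "i < p" for i
  proof -
    have "b' n $ i = b n $ i / real n" for n using b[of n] that by (simp add: b'_def)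
    thus ?thesis using limb[OF that] by simp
  qed
  have ld: "(\<lambda>n. det (A' n)) \<longlonglongrightarrow> det \<Gamma>" by (rule tendsto_det[OF A' \<Gamma> lA])
  define y where "y n = the (mat_inverse (A n)) *\<^sub>v b n" for n
  have "(\<lambda>n. (\<Sum>j<p. adj_mat (A' n) $$ (i, j) * b' n $ j) / det (A' n))
     \<longlonglongrightarrow> (\<Sum>j<p. adj_mat \<Gamma> $$ (i, j) * (\<Gamma> *\<^sub>v t) $ j) / det \<Gamma>"
    by (intro tendsto_divide tendsto_sum tendsto_mult tendsto_adj_mat[OF A' \<Gamma> lA] lb ld d i) auto
  also have "(\<Sum>j<p. adj_mat \<Gamma> $$ (i, j) * (\<Gamma> *\<^sub>v t) $ j) / det \<Gamma> = t $ i"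
    using cramer[OF \<Gamma> t i] d by simp
  finally have lim: "(\<lambda>n. (\<Sum>j<p. adj_mat (A' n) $$ (i, j) * b' n $ j) / det (A' n)) \<longlonglongrightarrow> t $ i" .
  have "\<forall>\<^sub>F n in sequentially. det (A' n) \<noteq> 0"
    using tendsto_imp_eventually_ne[OF ld d] .
  hence "\<forall>\<^sub>F n in sequentially. (\<Sum>j<p. adj_mat (A' n) $$ (i, j) * b' n $ j) / det (A' n) = y n $ i"
  proof eventually_elim
    case (elim n)
    hence "det (A n) \<noteq> 0" unfolding A'_def by auto
    from mat_inverse_solves[OF A this b] have y: "y n \<in> carrier_vec p" "A n *\<^sub>v y n = b n"
      unfolding y_def by auto
    have "A' n *\<^sub>v y n = (1 / real n) \<cdot>\<^sub>v (A n *\<^sub>v y n)"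
      unfolding A'_def using A[of n] y(1) by (intro eq_vecI) (auto simp: scalar_prod_def sum_distrib_left mult.assoc)
    hence "A' n *\<^sub>v y n = b' n" unfolding y(2) b'_def .
    with cramer[OF A' y(1) i, of n] elim show ?case by simp
  qed
  thus ?thesis unfolding y_def by (rule Lim_transform_eventually[OF lim])
qed

section \<open>The impulse response of the autoregression\<close>

lemma causal_fps_shift_nth:
  fixes x :: "int \<Rightarrow> real"
  assumes "causal x"
  shows "fps_nth (Abs_fps (\<lambda>n. x (int n)) * fps_X ^ i) n = x (int n - int i)"
  using assms by (auto simp: fps_X_power_mult_right_nth causal_def of_nat_diff)

definition ar_filter :: "nat \<Rightarrow> (nat \<Rightarrow> real) \<Rightarrow> real fps" where
  "ar_filter p \<theta> = 1 - (\<Sum>i<p. fps_const (\<theta> i) * fps_X ^ Suc i)"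

lemma fps_mult_ar_filter_nth:
  fixes x :: "int \<Rightarrow> real"
  assumes "causal x"
  shows "fps_nth (Abs_fps (\<lambda>n. x (int n)) * ar_filter p \<theta>) n
     = x (int n) - (\<Sum>i<p. \<theta> i * x (int n - 1 - int i))"
proof -
  have "Abs_fps (\<lambda>n. x (int n)) * ar_filter p \<theta>
    = Abs_fps (\<lambda>n. x (int n)) - (\<Sum>i<p. fps_const (\<theta> i) * (Abs_fps (\<lambda>n. x (int n)) * fps_X ^ Suc i))"
    unfolding ar_filter_def by (simp add: algebra_simps sum_distrib_left)
  also have "fps_nth \<dots> n = x (int n) - (\<Sum>i<p. \<theta> i * x (int n - int (Suc i)))"
    by (simp only: fps_sub_nth fps_sum_nth fps_mult_left_const_nth causal_fps_shift_nth[OF assms] fps_nth_Abs_fps)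
  finally show ?thesis by (simp add: algebra_simps)
qed

lemma ar_filter_0 [simp]: "fps_nth (ar_filter p \<theta>) 0 = 1"
  by (simp add: ar_filter_def fps_sum_nth)

text \<open>
  Summing \<open>\<bar>a\<^sub>n\<bar> \<le> \<Sum>\<^sub>i \<bar>\<theta>\<^sub>i\<bar> \<bar>a\<^sub>n\<^sub>-\<^sub>1\<^sub>-\<^sub>i\<bar> + \<bar>e\<^sub>n\<bar>\<close> over \<open>n\<close> bounds each partial sum \<open>A\<close> by
  \<open>\<parallel>\<theta>\<parallel>\<^sub>1 A + \<parallel>e\<parallel>\<^sub>1\<close>.
\<close>

lemma summable_ar_filter_quotient:
  fixes a :: "nat \<Rightarrow> real"
  assumes \<theta>: "(\<Sum>i<p. \<bar>\<theta> i\<bar>) < 1" and e: "summable (\<lambda>n. \<bar>e n\<bar>)"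
    and a: "Abs_fps a * ar_filter p \<theta> = Abs_fps e"
  shows "summable (\<lambda>n. \<bar>a n\<bar>)"
proof (rule summableI_nonneg_bounded)
  define x where "x k = (if k < 0 then 0 else a (nat k))" for k :: int
  have x: "causal x" "\<And>n. x (int n) = a n" by (auto simp: x_def causal_def)
  have rec: "a n = (\<Sum>i<p. \<theta> i * x (int n - 1 - int i)) + e n" for n
    using fps_mult_ar_filter_nth[OF x(1), of p \<theta> n] a by (simp add: x(2))
  define T where "T = (\<Sum>i<p. \<bar>\<theta> i\<bar>)"
  fix N
  define A where "A = (\<Sum>n<N. \<bar>a n\<bar>)"
  have delayed: "(\<Sum>n<N. \<bar>x (int n - 1 - int i)\<bar>) \<le> A" for i
  proof -
    have "causal (\<lambda>k. \<bar>x k\<bar>)" using x(1) by (simp add: causal_def)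
    from sum_delay[OF this, where n=N and i="Suc i" and w="\<lambda>_. 1"]
    have "(\<Sum>n<N. \<bar>x (int n - 1 - int i)\<bar>) = (\<Sum>n<N - Suc i. \<bar>a n\<bar>)"
      by (simp add: x(2) algebra_simps)
    also have "\<dots> \<le> A" unfolding A_def by (intro sum_mono2) auto
    finally show ?thesis .
  qed
  have "A \<le> (\<Sum>n<N. (\<Sum>i<p. \<bar>\<theta> i\<bar> * \<bar>x (int n - 1 - int i)\<bar>) + \<bar>e n\<bar>)"
    unfolding A_def
  proof (rule sum_mono)
    fix n
    have "\<bar>\<Sum>i<p. \<theta> i * x (int n - 1 - int i)\<bar> \<le> (\<Sum>i<p. \<bar>\<theta> i\<bar> * \<bar>x (int n - 1 - int i)\<bar>)"
      by (rule order.trans[OF sum_abs]) (simp add: abs_mult)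
    thus "\<bar>a n\<bar> \<le> (\<Sum>i<p. \<bar>\<theta> i\<bar> * \<bar>x (int n - 1 - int i)\<bar>) + \<bar>e n\<bar>"
      unfolding rec[of n] by linarith
  qed
  also have "\<dots> = (\<Sum>i<p. \<bar>\<theta> i\<bar> * (\<Sum>n<N. \<bar>x (int n - 1 - int i)\<bar>)) + (\<Sum>n<N. \<bar>e n\<bar>)"
    unfolding sum.distrib sum_distrib_left by (subst sum.swap) (rule refl)
  also have "\<dots> \<le> (\<Sum>i<p. \<bar>\<theta> i\<bar> * A) + (\<Sum>n. \<bar>e n\<bar>)"
    by (intro add_mono sum_mono mult_left_mono delayed sum_le_suminf[OF e]) auto
  also have "(\<Sum>i<p. \<bar>\<theta> i\<bar> * A) = T * A" by (simp add: T_def sum_distrib_right)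
  finally have "A * (1 - T) \<le> (\<Sum>n. \<bar>e n\<bar>)" by (simp add: algebra_simps)
  thus "(\<Sum>n<N. \<bar>a n\<bar>) \<le> (\<Sum>n. \<bar>e n\<bar>) / (1 - T)"
    using \<theta> unfolding A_def[symmetric] T_def[symmetric] by (simp add: pos_le_divide_eq)
qed simp

text \<open>
  In the ring of formal power series the recursion says that \<open>x\<close> times an invertible series equals
  \<open>v\<close>, and multiplication by the inverse series \<open>a\<close> isolates \<open>x\<close>.  The factor \<open>1 - \<rho>z\<close> has the geometric
  series as its inverse, which is the input to the filter \<open>\<theta>\<close> in the proof that \<open>a\<close> is summable.
\<close>

lemma ar_impulse_response:
  fixes \<theta> :: "nat \<Rightarrow> real"
  assumes \<theta>: "(\<Sum>i<p. \<bar>\<theta> i\<bar>) < 1" and \<rho>: "\<bar>\<rho>\<bar> < 1"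
  obtains a :: "nat \<Rightarrow> real" where "summable (\<lambda>n. \<bar>a n\<bar>)" "a 0 = 1"
    "\<And>x v. causal x \<Longrightarrow> causal v \<Longrightarrow>
       (\<And>k. k \<ge> 0 \<Longrightarrow> x k = (\<Sum>i<p. \<theta> i * x (k - 1 - int i))
          + \<rho> * (x (k - 1) - (\<Sum>i<p. \<theta> i * x (k - 2 - int i))) + v k) \<Longrightarrow> x = convolve a v"
proof
  let ?R = "1 - fps_const \<rho> * fps_X :: real fps"
  let ?F = "ar_filter p \<theta> * ?R"
  define a where "a n = fps_nth (inverse ?F) n" for n
  have F0: "fps_nth ?F 0 \<noteq> 0" by simp
  have aF: "Abs_fps a * ?F = 1"
    unfolding a_def using inverse_mult_eq_1[OF F0] by (simp add: fps_nth_inverse)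
  have geom: "Abs_fps (\<lambda>n. \<rho> ^ n) * ?R = 1"
    by (rule fps_ext) (auto simp: algebra_simps fps_mult_right_const_nth power_eq_if)
  have "Abs_fps a * ar_filter p \<theta> * ?R = Abs_fps (\<lambda>n. \<rho> ^ n) * ?R"
    using aF geom by (simp add: mult.assoc)
  moreover have "?R \<noteq> 0" by (metis fps_mult_nth_0 geom mult_zero_right zero_neq_one)
  ultimately have "Abs_fps a * ar_filter p \<theta> = Abs_fps (\<lambda>n. \<rho> ^ n)" by simp
  thus "summable (\<lambda>n. \<bar>a n\<bar>)"
    by (rule summable_ar_filter_quotient[OF \<theta>, rotated]) (use \<rho> in \<open>simp add: power_abs summable_geometric\<close>)
  show "a 0 = 1" by (simp add: a_def)
  fix x v :: "int \<Rightarrow> real"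
  assume x: "causal x" and v: "causal v"
    and rec: "\<And>k. k \<ge> 0 \<Longrightarrow> x k = (\<Sum>i<p. \<theta> i * x (k - 1 - int i))
          + \<rho> * (x (k - 1) - (\<Sum>i<p. \<theta> i * x (k - 2 - int i))) + v k"
  define e where "e k = x k - (\<Sum>i<p. \<theta> i * x (k - 1 - int i))" for k
  have e: "causal e" using x by (auto simp: causal_def e_def)
  have "Abs_fps (\<lambda>n. x (int n)) * ar_filter p \<theta> = Abs_fps (\<lambda>n. e (int n))"
    by (rule fps_ext) (simp add: fps_mult_ar_filter_nth[OF x] e_def)
  moreover have "Abs_fps (\<lambda>n. e (int n)) * ?R = Abs_fps (\<lambda>n. v (int n))"
  proof (rule fps_ext)
    fix n
    have "fps_nth (Abs_fps (\<lambda>n. e (int n)) * ?R) n = e (int n) - \<rho> * e (int n - 1)"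
      using causal_fps_shift_nth[OF e, of 1 n]
      by (simp add: right_diff_distrib mult.left_commute[of _ "fps_const \<rho>"] del: fps_X_mult_right_nth)
    also have "\<dots> = v (int n)"
      using rec[of "int n"] by (simp add: e_def algebra_simps)
    finally show "fps_nth (Abs_fps (\<lambda>n. e (int n)) * ?R) n = fps_nth (Abs_fps (\<lambda>n. v (int n))) n" by simp
  qed
  ultimately have xF: "Abs_fps (\<lambda>n. x (int n)) * ?F = Abs_fps (\<lambda>n. v (int n))"
    by (simp add: mult.assoc[symmetric])
  have "Abs_fps (\<lambda>n. x (int n)) = Abs_fps (\<lambda>n. x (int n)) * (Abs_fps a * ?F)" by (simp only: aF mult_1_right)
  also have "\<dots> = Abs_fps a * (Abs_fps (\<lambda>n. x (int n)) * ?F)" by (simp only: mult_ac)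
  also have "\<dots> = Abs_fps a * Abs_fps (\<lambda>n. v (int n))" by (simp only: xF)
  finally have fps: "fps_nth (Abs_fps (\<lambda>n. x (int n))) n = fps_nth (Abs_fps a * Abs_fps (\<lambda>n. v (int n))) n" for n
    by simp
  show "x = convolve a v"
  proof
    fix k
    show "x k = convolve a v k"
    proof (cases "k < 0")
      case True
      thus ?thesis using x by (simp add: causal_def convolve_def)
    next
      case False
      thus ?thesis using fps[of "nat k"]
        by (simp add: fps_mult_nth convolve_def atMost_atLeast0 of_nat_diff)
    qed
  qed
qed

section \<open>Limits of the estimators\<close>

lemma has_lag_cov_evenI:
  assumes v: "causal v" and even: "\<And>h. g (- h) = g h"
    and lim: "\<And>l. (\<lambda>n. (\<Sum>k<n. v (int k) * v (int k + int l)) / real n) \<longlonglongrightarrow> g (int l)"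
  shows "has_lag_cov v v g"
  unfolding has_lag_cov_def
proof
  fix h
  show "(\<lambda>n. (\<Sum>k<n. v (int k) * v (int k + h)) / real n) \<longlonglongrightarrow> g h"
  proof (cases "h \<ge> 0")
    case True
    thus ?thesis using lim[of "nat h"] by simp
  next
    case False
    define l where "l = nat (- h)"
    have h: "h = - int l" using False by (simp add: l_def)
    have "(\<Sum>k<n. v (int k) * v (int k + h)) = (\<Sum>k<n - l. v (int k) * v (int k + int l))" for n
      using sum_delay[OF v, where n=n and i=l and w=v] by (simp add: h mult.commute)
    thus ?thesis using average_delay[OF lim[of l], of l] by (simp add: h even)
  qed
qed

lemma theta_hat_tendsto:
  assumes S: "S \<in> carrier_mat p p" and xx: "has_lag_cov x x \<gamma>" and x: "causal x"
    and pos: "\<And>u :: nat \<Rightarrow> real. \<exists>i<p. u i \<noteq> 0 \<Longrightarrow> (\<Sum>i<p. \<Sum>j<p. u i * u j * \<gamma> (int i - int j)) > 0"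
    and t: "\<And>i. i < p \<Longrightarrow> (\<Sum>j<p. t j * \<gamma> (int i - int j)) = \<gamma> (int i + 1)"
    and i: "i < p"
  shows "(\<lambda>n. theta_hat p S x n $ i) \<longlonglongrightarrow> t i"
proof -
  define \<Gamma> where "\<Gamma> = mat p p (\<lambda>(i, j). \<gamma> (int i - int j))"
  have \<Gamma>: "\<Gamma> \<in> carrier_mat p p" by (simp add: \<Gamma>_def)
  have \<Gamma>v: "(\<Gamma> *\<^sub>v w) $ i = (\<Sum>j<p. \<gamma> (int i - int j) * w $ j)" if "w \<in> carrier_vec p" "i < p" for w i
    using that by (simp add: \<Gamma>_def scalar_prod_def lessThan_atLeast0)
  have det: "det \<Gamma> \<noteq> 0"
  proof
    assume "det \<Gamma> = 0"
    then obtain w where w: "w \<in> carrier_vec p" "w \<noteq> 0\<^sub>v p" "\<Gamma> *\<^sub>v w = 0\<^sub>v p"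
      using det_0_iff_vec_prod_zero_field[OF \<Gamma>] by blast
    have "\<exists>i<p. w $ i \<noteq> 0"
    proof (rule ccontr)
      assume "\<not> ?thesis"
      hence "w = 0\<^sub>v p" using w(1) by (intro eq_vecI) auto
      thus False using w(2) by simp
    qed
    from pos[OF this] have "0 < (\<Sum>i<p. w $ i * (\<Gamma> *\<^sub>v w) $ i)"
      by (simp add: \<Gamma>v[OF w(1)] sum_distrib_left mult_ac)
    thus False by (simp add: w(3))
  qed
  have lin: "(\<lambda>n. (the (mat_inverse (gram p S x (n - 1))) *\<^sub>v
     finsum_vec TYPE(real) p (\<lambda>k. x (int k) \<cdot>\<^sub>v regressor p x (k - 1)) {1..n}) $ i) \<longlonglongrightarrow> vec p t $ i"
  proof (rule tendsto_linear_solution[OF _ _ \<Gamma> _ det _ _ i])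
    show "gram p S x (n - 1) \<in> carrier_mat p p" for n using S by (simp add: gram_def)
    show "finsum_vec TYPE(real) p (\<lambda>k. x (int k) \<cdot>\<^sub>v regressor p x (k - 1)) {1..n} \<in> carrier_vec p" for n
      by (rule finsum_vec_closed) (auto simp: regressor_def)
    show "vec p t \<in> carrier_vec p" by simp
    fix i assume i: "i < p"
    {
      fix j assume j: "j < p"
      have "(\<lambda>n. (\<Sum>k<n. x (int k - int i) * x (int k + - int j)) / real n + S $$ (i, j) / real n)
         \<longlonglongrightarrow> \<gamma> (- int j + int i) + 0"
        by (intro tendsto_add has_lag_cov_delay[OF xx x] lim_const_over_n)
      moreover have "\<forall>\<^sub>F n in sequentially. (\<Sum>k<n. x (int k - int i) * x (int k + - int j)) / real n + S $$ (i, j) / real n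
          = gram p S x (n - 1) $$ (i, j) / real n"
        using eventually_gt_at_top[of 0]
      proof eventually_elim
        case (elim n)
        have "{0..n - 1} = {..<n}" using elim by auto
        thus ?case using i j S by (simp add: gram_def regressor_def add_divide_distrib)
      qed
      ultimately show "(\<lambda>n. gram p S x (n - 1) $$ (i, j) / real n) \<longlonglongrightarrow> \<Gamma> $$ (i, j)"
        using i j by (simp add: \<Gamma>_def Lim_transform_eventually)
    }
    have "finsum_vec TYPE(real) p (\<lambda>k. x (int k) \<cdot>\<^sub>v regressor p x (k - 1)) {1..n} $ i
        = (\<Sum>k<n. x (int k - int i) * x (int k + 1))" for n
    proof -
      have "finsum_vec TYPE(real) p (\<lambda>k. x (int k) \<cdot>\<^sub>v regressor p x (k - 1)) {1..n} $ i
        = (\<Sum>k\<in>{1..n}. (x (int k) \<cdot>\<^sub>v regressor p x (k - 1)) $ i)"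
        using i by (intro index_finsum_vec) (auto simp: regressor_def)
      also have "\<dots> = (\<Sum>k<n. x (int k - int i) * x (int k + 1))"
        using i by (simp add: sum.atLeast1_atMost_eq regressor_def mult.commute add.commute)
      finally show ?thesis .
    qed
    moreover have "(\<Gamma> *\<^sub>v vec p t) $ i = \<gamma> (1 + int i)"
      using t[OF i] i by (simp add: \<Gamma>v add.commute mult.commute)
    ultimately show "(\<lambda>n. finsum_vec TYPE(real) p (\<lambda>k. x (int k) \<cdot>\<^sub>v regressor p x (k - 1)) {1..n} $ i / real n)
       \<longlonglongrightarrow> (\<Gamma> *\<^sub>v vec p t) $ i"
      using has_lag_cov_delay[OF xx x, of i 1] by simp
  qed
  thus ?thesis using i by (simp add: theta_hat_def)
qed

text \<open>
  Since \<open>x\<close> vanishes at negative times, the first residual \<open>x\<^sub>0\<close> obeys the same formula as the others.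
\<close>

lemma residual_eq_sum:
  assumes x: "causal x"
  shows "residual p S x n k = (\<Sum>i<Suc p. residual_coeff (\<lambda>i. theta_hat p S x n $ i) i * x (int k - int i))"
proof (cases k)
  case 0
  have "x (- 1 - int i) = 0" for i using x by (simp add: causal_def)
  thus ?thesis unfolding 0 by (subst sum.lessThan_Suc_shift) (simp add: residual_def residual_coeff_def)
next
  case (Suc m)
  have "theta_hat p S x n \<bullet> regressor p x m = (\<Sum>i<p. theta_hat p S x n $ i * x (int m - int i))"
    by (simp add: scalar_prod_def regressor_def lessThan_atLeast0)
  thus ?thesis unfolding Suc
    by (subst sum.lessThan_Suc_shift) (simp add: residual_def residual_coeff_def sum_negf add.commute)
qed

lemma rho_hat_tendsto:
  assumes xx: "has_lag_cov x x \<gamma>" and x: "causal x"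
    and th: "\<And>i. i < p \<Longrightarrow> (\<lambda>n. theta_hat p S x n $ i) \<longlonglongrightarrow> t i"
    and pos: "(\<Sum>i<Suc p. \<Sum>j<Suc p. residual_coeff t i * residual_coeff t j * \<gamma> (int i - int j)) \<noteq> 0"
  shows "(\<lambda>n. rho_hat p S x n) \<longlonglongrightarrow>
     (\<Sum>i<Suc p. \<Sum>j<Suc p. residual_coeff t i * residual_coeff t j * \<gamma> (1 + int i - int j))
     / (\<Sum>i<Suc p. \<Sum>j<Suc p. residual_coeff t i * residual_coeff t j * \<gamma> (int i - int j))"
proof -
  let ?c = "\<lambda>i n. residual_coeff (\<lambda>i. theta_hat p S x n $ i) i"
  have c: "?c i \<longlonglongrightarrow> residual_coeff t i" if "i < Suc p" for i
    unfolding residual_coeff_def using that th[of "i - 1"] by (cases "i = 0") (auto intro!: tendsto_intros)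
  let ?N = "\<lambda>h n. (\<Sum>k<n. (\<Sum>i<Suc p. ?c i n * x (int k - int i)) * (\<Sum>j<Suc p. ?c j n * x (int k + h - int j))) / real n"
  have N: "?N h \<longlonglongrightarrow> (\<Sum>i<Suc p. \<Sum>j<Suc p. residual_coeff t i * residual_coeff t j * \<gamma> (h + int i - int j))" for h
    by (rule has_lag_cov_combination[OF xx x c c])
  have "(\<lambda>n. ?N 1 n / ?N 0 n) \<longlonglongrightarrow> (\<Sum>i<Suc p. \<Sum>j<Suc p. residual_coeff t i * residual_coeff t j * \<gamma> (1 + int i - int j))
     / (\<Sum>i<Suc p. \<Sum>j<Suc p. residual_coeff t i * residual_coeff t j * \<gamma> (0 + int i - int j))"
    by (rule tendsto_divide[OF N N]) (use pos in simp)
  moreover have "\<forall>\<^sub>F n in sequentially. ?N 1 n / ?N 0 n = rho_hat p S x n"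
    using eventually_gt_at_top[of 0]
  proof eventually_elim
    case (elim n)
    have "(\<Sum>k = 1..n. residual p S x n k * residual p S x n (k - 1)) = (\<Sum>k<n. residual p S x n k * residual p S x n (Suc k))"
      by (simp add: sum.atLeast1_atMost_eq mult.commute)
    also have "\<dots> = (\<Sum>k<n. (\<Sum>i<Suc p. ?c i n * x (int k - int i)) * (\<Sum>j<Suc p. ?c j n * x (int k + 1 - int j)))"
      unfolding residual_eq_sum[OF x] by (simp only: of_nat_Suc add.commute)
    finally have 1: "(\<Sum>k = 1..n. residual p S x n k * residual p S x n (k - 1)) / real n = ?N 1 n" by simp
    have "(\<Sum>k = 1..n. (residual p S x n (k - 1))\<^sup>2) = (\<Sum>k<n. residual p S x n k * residual p S x n k)"
      by (simp add: sum.atLeast1_atMost_eq power2_eq_square)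
    also have "\<dots> = (\<Sum>k<n. (\<Sum>i<Suc p. ?c i n * x (int k - int i)) * (\<Sum>j<Suc p. ?c j n * x (int k + 0 - int j)))"
      unfolding residual_eq_sum[OF x] by (simp only: add_0_right)
    finally have 0: "(\<Sum>k = 1..n. (residual p S x n (k - 1))\<^sup>2) / real n = ?N 0 n" by simp
    show ?case unfolding 0[symmetric] 1[symmetric] rho_hat_def using elim by (simp add: divide_inverse)
  qed
  ultimately show ?thesis by (simp add: Lim_transform_eventually del: sum.lessThan_Suc)
qed

text \<open>
  The estimators only see the times from \<open>-p\<close> on, so that a trajectory may be set to zero before.
\<close>

lemma rho_hat_cong:
  assumes "\<And>k. k \<ge> - int p \<Longrightarrow> x k = y k"
  shows "rho_hat p S x n = rho_hat p S y n"
proof -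
  have "regressor p x k = regressor p y k" for k
    unfolding regressor_def using assms by (intro eq_vecI) auto
  hence "regressor p x = regressor p y" by blast
  moreover have xy: "x (int k) = y (int k)" for k using assms by simp
  ultimately have "theta_hat p S x = theta_hat p S y"
    by (simp add: theta_hat_def[abs_def] gram_def)
  hence "residual p S x = residual p S y"
    using xy[of 0] \<open>regressor p x = regressor p y\<close> by (auto simp: residual_def xy fun_eq_iff)
  thus ?thesis by (simp add: rho_hat_def)
qed

lemma theta_star_index:
  assumes i: "i < p"
  shows "theta_star p \<theta> \<rho> $ i
    = alpha p \<theta> \<rho> * (beta p \<theta> \<rho> $ i - \<theta> $ (p - 1) * \<rho> * beta p \<theta> \<rho> $ (p - 1 - i))"
proof -
  let ?c = "\<theta> $ (p - 1) * \<rho>"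
  have b: "beta p \<theta> \<rho> \<in> carrier_vec p" by (simp add: beta_def)
  have "((1\<^sub>m p - ?c \<cdot>\<^sub>m exchange_mat p) *\<^sub>v beta p \<theta> \<rho>) $ i
     = (\<Sum>j<p. ((if i = j then 1 else 0) - ?c * (if i + j + 1 = p then 1 else 0)) * beta p \<theta> \<rho> $ j)"
    using i b by (simp add: exchange_mat_def scalar_prod_def lessThan_atLeast0)
  also have "\<dots> = (\<Sum>j<p. if i = j then beta p \<theta> \<rho> $ j else 0)
      - ?c * (\<Sum>j<p. if j = p - 1 - i then beta p \<theta> \<rho> $ j else 0)"
    unfolding sum_distrib_left sum_subtractf[symmetric] using i by (intro sum.cong) (auto simp: algebra_simps)
  also have "\<dots> = beta p \<theta> \<rho> $ i - ?c * beta p \<theta> \<rho> $ (p - 1 - i)"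
    using i by simp
  finally show ?thesis using i b by (simp add: theta_star_def exchange_mat_def)
qed

text \<open>
  This is \<open>(I + cJ) \<theta>\<^sup>* = \<beta>\<close>, obtained from \<open>(I + cJ)(I - cJ) = (1 - c\<^sup>2) I = \<alpha>\<^sup>-\<^sup>1 I\<close>.
\<close>

lemma theta_star_reflection:
  assumes i: "i < p" and c: "\<bar>\<theta> $ (p - 1) * \<rho>\<bar> < 1"
  shows "theta_star p \<theta> \<rho> $ i + \<theta> $ (p - 1) * \<rho> * theta_star p \<theta> \<rho> $ (p - 1 - i) = beta p \<theta> \<rho> $ i"
proof -
  let ?c = "\<theta> $ (p - 1) * \<rho>"
  have ne: "(1 - ?c) * (1 + ?c) \<noteq> 0" using c by auto
  have i': "p - 1 - i < p" "p - 1 - (p - 1 - i) = i" using i by auto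
  have "theta_star p \<theta> \<rho> $ i + ?c * theta_star p \<theta> \<rho> $ (p - 1 - i)
      = alpha p \<theta> \<rho> * ((1 - ?c) * (1 + ?c)) * beta p \<theta> \<rho> $ i"
    unfolding theta_star_index[OF i] theta_star_index[OF i'(1)] i'(2) by (simp add: algebra_simps)
  thus ?thesis using ne by (simp add: alpha_def)
qed

text \<open>
  The deterministic core of the theorem: a single trajectory whose noise behaves like white noise on
  average.
\<close>

lemma rho_hat_tendsto_of_noise:
  assumes p: "p \<ge> 1" and \<theta>: "(\<Sum>i<p. \<bar>\<theta> $ i\<bar>) < 1" and \<rho>: "\<bar>\<rho>\<bar> < 1" and s: "s > 0"
    and S: "S \<in> carrier_mat p p"
    and x: "causal x" and v: "causal v" and vv: "has_lag_cov v v (white_cov s)"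
    and rec: "\<And>k. k \<ge> 0 \<Longrightarrow> x k = (\<Sum>i<p. \<theta> $ i * x (k - 1 - int i))
        + \<rho> * (x (k - 1) - (\<Sum>i<p. \<theta> $ i * x (k - 2 - int i))) + v k"
  shows "(\<lambda>n. rho_hat p S x n) \<longlonglongrightarrow> rho_star p \<theta> \<rho>"
proof -
  define c where "c = \<theta> $ (p - 1) * \<rho>"
  define t where "t i = theta_star p \<theta> \<rho> $ i" for i
  define b where "b i = beta p \<theta> \<rho> $ i" for i
  have "\<bar>\<theta> $ (p - 1)\<bar> \<le> (\<Sum>i<p. \<bar>\<theta> $ i\<bar>)" using p by (intro member_le_sum) auto
  hence "\<bar>c\<bar> \<le> 1 * \<bar>\<rho>\<bar>" unfolding c_def abs_mult using \<theta> by (intro mult_right_mono) auto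
  hence c: "\<bar>c\<bar> < 1" using \<rho> by simp
  obtain a where a: "summable (\<lambda>n. \<bar>a n\<bar>)" "a 0 = 1"
    and response: "\<And>x v. causal x \<Longrightarrow> causal v \<Longrightarrow>
       (\<And>k. k \<ge> 0 \<Longrightarrow> x k = (\<Sum>i<p. \<theta> $ i * x (k - 1 - int i))
          + \<rho> * (x (k - 1) - (\<Sum>i<p. \<theta> $ i * x (k - 2 - int i))) + v k) \<Longrightarrow> x = convolve a v"
    by (rule ar_impulse_response[OF \<theta> \<rho>]) blast
  have xa: "x = convolve a v" by (rule response[OF x v rec])
  obtain \<gamma> where xx: "has_lag_cov x x \<gamma>"
    using has_lag_cov_filtered_noise(2)[OF vv v a(1)] unfolding xa by blast
  have xv: "has_lag_cov x v (\<lambda>h. if h \<le> 0 then a (nat (- h)) * s else 0)"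
    using has_lag_cov_filtered_noise(1)[OF vv v a(1)] unfolding xa .
  note pos = lag_cov_pos_def[OF xx vv xv x v a(2) s]
  have even: "\<gamma> (- h) = \<gamma> h" for h by (rule has_lag_cov_even[OF xx x])
  have yw: "\<gamma> h = (\<Sum>i<p. b i * \<gamma> (h - 1 - int i)) - c * \<gamma> (h - 1 - int p)" if "1 \<le> h" for h
  proof -
    have "\<gamma> h = (\<Sum>i<p. \<theta> $ i * \<gamma> (h - 1 - int i)) + \<rho> * (\<gamma> (h - 1) - (\<Sum>i<p. \<theta> $ i * \<gamma> (h - 2 - int i)))"
      by (rule yule_walker[OF xx xv rec that])
    also have "\<dots> = (\<Sum>i<p. b i * \<gamma> (h - 1 - int i)) - c * \<gamma> (h - 1 - int p)"
      using sum_ar_coefficients[OF p, of b "\<lambda>i. \<theta> $ i" \<rho> "\<lambda>i. \<gamma> (h - 1 - int i)"]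
      by (simp add: b_def beta_def c_def algebra_simps)
    finally show ?thesis .
  qed
  have tb: "t i + c * t (p - 1 - i) = b i" if "i < p" for i
    using theta_star_reflection[OF that c[unfolded c_def]] by (simp add: t_def b_def c_def)
  note eqs = even c tb yw
  have th: "(\<lambda>n. theta_hat p S x n $ i) \<longlonglongrightarrow> t i" if "i < p" for i
    by (rule theta_hat_tendsto[OF S xx x pos _ that]) (use normal_equations[OF eqs] in auto)
  define E where "E = \<gamma> 0 - (\<Sum>j<p. t j * \<gamma> (int j + 1))"
  have Q0: "(\<Sum>i<Suc p. \<Sum>j<Suc p. residual_coeff t i * residual_coeff t j * \<gamma> (int i - int j)) = E"
    unfolding E_def by (rule residual_variance[OF eqs])
  have Q1: "(\<Sum>i<Suc p. \<Sum>j<Suc p. residual_coeff t i * residual_coeff t j * \<gamma> (1 + int i - int j)) = c * t (p - 1) * E"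
    unfolding E_def by (rule residual_lag_one_covariance[OF eqs p])
  have "\<exists>i<Suc p. residual_coeff t i \<noteq> 0"
    by (intro exI[of _ 0]) (simp add: residual_coeff_def)
  from pos[OF this] have E: "E > 0" unfolding Q0 .
  have "(\<lambda>n. rho_hat p S x n) \<longlonglongrightarrow> c * t (p - 1) * E / E"
    using rho_hat_tendsto[OF xx x th, unfolded Q0 Q1] E by simp
  thus ?thesis using E by (simp add: rho_star_def c_def t_def)
qed

section \<open>Consistency\<close>

text \<open>
  The value \<open>c\<close> at time zero stands for \<open>X\<^sub>0(\<omega>)\<close>.  It enters the sums only through the term of time zero,
  which vanishes after division by \<open>n\<close>, so that one null set serves all \<open>c\<close> and \<open>c\<close> may then be chosen
  depending on \<open>\<omega>\<close>.
\<close>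

lemma (in prob_space) AE_has_lag_cov_noise:
  fixes V :: "nat \<Rightarrow> 'a \<Rightarrow> real"
  assumes ind: "indep_vars (\<lambda>_. borel) V {1..}"
    and id: "\<And>m n. m \<ge> 1 \<Longrightarrow> n \<ge> 1 \<Longrightarrow> distr M borel (V m) = distr M borel (V n)"
    and int: "\<And>n. n \<ge> 1 \<Longrightarrow> integrable M (\<lambda>\<omega>. (V n \<omega>)\<^sup>2)"
    and mean: "\<And>n. n \<ge> 1 \<Longrightarrow> expectation (V n) = 0"
    and var: "\<And>n. n \<ge> 1 \<Longrightarrow> variance (V n) = s"
  shows "AE \<omega> in M. \<forall>c. has_lag_cov (\<lambda>k. if k < 0 then 0 else if k = 0 then c else V (nat k) \<omega>)
      (\<lambda>k. if k < 0 then 0 else if k = 0 then c else V (nat k) \<omega>) (white_cov s)"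
proof -
  have meas: "V k \<in> borel_measurable M" if "k \<ge> 1" for k
    using ind that by (auto simp: indep_vars_def)
  have sq: "expectation (\<lambda>\<omega>. (V n \<omega>)\<^sup>2) = s" if "n \<ge> 1" for n
    using var[OF that] mean[OF that] by simp
  have "AE \<omega> in M. (\<lambda>n. (\<Sum>k=1..n. (V k \<omega>)\<^sup>2) / n) \<longlonglongrightarrow> expectation (\<lambda>\<omega>. (V 1 \<omega>)\<^sup>2)"
  proof (rule strong_law_nonneg)
    show "indep_vars (\<lambda>_. borel) (\<lambda>k \<omega>. (V k \<omega>)\<^sup>2) {1..}"
      by (rule indep_vars_compose2[OF ind]) measurable
    fix k :: nat assume k: "k \<ge> 1"
    have "distr (distr M borel (V k)) borel (\<lambda>y. y\<^sup>2) = distr (distr M borel (V 1)) borel (\<lambda>y. y\<^sup>2)"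
      using id[OF k, of 1] by simp
    thus "distr M borel (\<lambda>\<omega>. (V k \<omega>)\<^sup>2) = distr M borel (\<lambda>\<omega>. (V 1 \<omega>)\<^sup>2)"
      using meas[OF k] meas[of 1] by (simp add: distr_distr comp_def)
  qed (use int in auto)
  hence square: "AE \<omega> in M. (\<lambda>n. (\<Sum>k=1..n. (V k \<omega>)\<^sup>2) / n) \<longlonglongrightarrow> s" by (simp add: sq)
  have "AE \<omega> in M. \<forall>h. h \<ge> 1 \<longrightarrow> (\<lambda>n. (\<Sum>k=1..n. V k \<omega> * V (k + h) \<omega>) / n) \<longlonglongrightarrow> 0"
    unfolding AE_all_countable
    using average_lagged_products_tendsto_0[OF ind int mean sq square] by auto
  with square show ?thesis
  proof eventually_elim
    case (elim \<omega>)
    show ?case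
    proof
      fix c
      let ?v = "\<lambda>k::int. if k < 0 then 0 else if k = 0 then c else V (nat k) \<omega>"
      show "has_lag_cov ?v ?v (white_cov s)"
      proof (rule has_lag_cov_evenI)
        fix l
        have "(\<lambda>n. (\<Sum>k=1..n. V k \<omega> * V (k + l) \<omega>) / n) \<longlonglongrightarrow> white_cov s (int l)"
          using elim by (cases "l = 0") (auto simp: white_cov_def power2_eq_square)
        from average_delay[OF this, of 1]
        have "(\<lambda>n. ?v 0 * ?v (int l) / real n + (\<Sum>k=1..n - 1. V k \<omega> * V (k + l) \<omega>) / n) \<longlonglongrightarrow> 0 + white_cov s (int l)"
          by (intro tendsto_add lim_const_over_n)
        moreover have "\<forall>\<^sub>F n in sequentially. ?v 0 * ?v (int l) / real n + (\<Sum>k=1..n - 1. V k \<omega> * V (k + l) \<omega>) / n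
            = (\<Sum>k<n. ?v (int k) * ?v (int k + int l)) / real n"
          using eventually_gt_at_top[of 0]
        proof eventually_elim
          case (elim n)
          then obtain m where n: "n = Suc m" by (cases n) auto
          have "(\<Sum>k<n. ?v (int k) * ?v (int k + int l)) = ?v 0 * ?v (int l) + (\<Sum>k<m. V (Suc k) \<omega> * V (Suc k + l) \<omega>)"
            unfolding n by (subst sum.lessThan_Suc_shift) (simp add: nat_add_distrib add.commute)
          thus ?case by (simp add: n sum.atLeast1_atMost_eq add_divide_distrib)
        qed
        ultimately show "(\<lambda>n. (\<Sum>k<n. ?v (int k) * ?v (int k + int l)) / real n) \<longlonglongrightarrow> white_cov s (int l)"
          by (simp add: Lim_transform_eventually)
      qed (auto simp: causal_def white_cov_def)
    qed
  qed
qed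

theorem theorem3p1:
  fixes M :: "'a measure"
    and p :: nat and \<theta> :: "real vec" and \<rho> \<sigma> :: real and S :: "real mat"
    and X :: "int \<Rightarrow> 'a \<Rightarrow> real" and \<epsilon> V :: "nat \<Rightarrow> 'a \<Rightarrow> real"
  assumes "prob_space M"
    and "p \<ge> 1"
    and "\<theta> \<in> carrier_vec p" and "\<theta> \<noteq> 0\<^sub>v p" and "(\<Sum>i<p. \<bar>\<theta> $ i\<bar>) < 1"
    and "\<bar>\<rho>\<bar> < 1"
    and "\<sigma>\<^sup>2 > 0"
    and "pos_def_mat p S"
    and "prob_space.indep_vars M (\<lambda>_. borel) V {1..}"
    and "\<And>m n. m \<ge> 1 \<Longrightarrow> n \<ge> 1 \<Longrightarrow> distr M borel (V m) = distr M borel (V n)"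
    and "\<And>n. n \<ge> 1 \<Longrightarrow> integrable M (\<lambda>\<omega>. (V n \<omega>)\<^sup>2)"
    and "\<And>n. n \<ge> 1 \<Longrightarrow> prob_space.expectation M (V n) = 0"
    and "\<And>n. n \<ge> 1 \<Longrightarrow> prob_space.variance M (V n) = \<sigma>\<^sup>2"
    and "X 0 \<in> borel_measurable M" and "integrable M (\<lambda>\<omega>. (X 0 \<omega>)\<^sup>2)"
    and "\<And>\<omega>. \<omega> \<in> space M \<Longrightarrow> X 0 \<omega> = \<epsilon> 0 \<omega>"
    and "\<And>k \<omega>. 1 \<le> k \<Longrightarrow> k \<le> p \<Longrightarrow> \<omega> \<in> space M \<Longrightarrow> X (- int k) \<omega> = 0"
    and "\<And>n \<omega>. n \<ge> 1 \<Longrightarrow> \<omega> \<in> space M \<Longrightarrow>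
           X (int n) \<omega> = (\<Sum>i = 1..p. \<theta> $ (i - 1) * X (int n - int i) \<omega>) + \<epsilon> n \<omega>"
    and "\<And>n \<omega>. n \<ge> 1 \<Longrightarrow> \<omega> \<in> space M \<Longrightarrow> \<epsilon> n \<omega> = \<rho> * \<epsilon> (n - 1) \<omega> + V n \<omega>"
  shows "AE \<omega> in M. (\<lambda>n. rho_hat p S (\<lambda>k. X k \<omega>) n) \<longlonglongrightarrow> rho_star p \<theta> \<rho>"
proof -
  interpret prob_space M by fact
  note start = assms(16) and past = assms(17) and X_rec = assms(18) and \<epsilon>_rec = assms(19)
  have S: "S \<in> carrier_mat p p" using assms(8) by (simp add: pos_def_mat_def)
  have "AE \<omega> in M. \<forall>c. has_lag_cov (\<lambda>k. if k < 0 then 0 else if k = 0 then c else V (nat k) \<omega>)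
      (\<lambda>k. if k < 0 then 0 else if k = 0 then c else V (nat k) \<omega>) (white_cov (\<sigma>\<^sup>2))"
    by (rule AE_has_lag_cov_noise) (fact assms(9-13))+
  from this AE_space show ?thesis
  proof eventually_elim
    case (elim \<omega>)
    define x where "x k = (if k < 0 then 0 else X k \<omega>)" for k
    define v where "v k = (if k < 0 then 0 else if k = 0 then X 0 \<omega> else V (nat k) \<omega>)" for k :: int
    have x: "causal x" and v: "causal v" by (auto simp: causal_def x_def v_def)
    have vv: "has_lag_cov v v (white_cov (\<sigma>\<^sup>2))"
      using elim(1) unfolding v_def[abs_def] by blast
    have xX: "x k = X k \<omega>" if "k \<ge> - int p" for k
    proof (cases "k < 0")
      case True
      thus ?thesis using past[of "nat (- k)" \<omega>] that elim(2) by (simp add: x_def)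
    qed (simp add: x_def)
    have noise: "x (int n) - (\<Sum>i<p. \<theta> $ i * x (int n - 1 - int i)) = \<epsilon> n \<omega>" for n
    proof (cases "n = 0")
      case True
      thus ?thesis using start[OF elim(2)] x by (simp add: x_def)
    next
      case False
      have "(\<Sum>i = 1..p. \<theta> $ (i - 1) * X (int n - int i) \<omega>) = (\<Sum>i<p. \<theta> $ i * x (int n - 1 - int i))"
        using False by (simp add: sum.atLeast1_atMost_eq xX algebra_simps)
      thus ?thesis using X_rec[of n \<omega>] False elim(2) by (simp add: xX)
    qed
    have rec: "x k = (\<Sum>i<p. \<theta> $ i * x (k - 1 - int i))
        + \<rho> * (x (k - 1) - (\<Sum>i<p. \<theta> $ i * x (k - 2 - int i))) + v k" if "k \<ge> 0" for k
    proof (cases "k = 0")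
      case True
      thus ?thesis by (simp add: x_def v_def)
    next
      case False
      define n where "n = nat k"
      have n: "k = int n" "n \<ge> 1" using that False by (auto simp: n_def)
      have "x (int (n - 1)) - (\<Sum>i<p. \<theta> $ i * x (int (n - 1) - 1 - int i)) = \<epsilon> (n - 1) \<omega>" by (rule noise)
      hence "x (k - 1) - (\<Sum>i<p. \<theta> $ i * x (k - 2 - int i)) = \<epsilon> (n - 1) \<omega>"
        using n by (simp add: of_nat_diff algebra_simps)
      moreover have "v k = V n \<omega>" using n by (simp add: v_def)
      ultimately show ?thesis
        using noise[of n] \<epsilon>_rec[OF n(2) elim(2)] n(1) by simp
    qed
    have "(\<lambda>n. rho_hat p S x n) \<longlonglongrightarrow> rho_star p \<theta> \<rho>"
      by (rule rho_hat_tendsto_of_noise[OF assms(2,5,6,7) S x v vv rec])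
    moreover have "rho_hat p S (\<lambda>k. X k \<omega>) n = rho_hat p S x n" for n
      by (rule rho_hat_cong) (simp add: xX)
    ultimately show ?case by simp
  qed
qed

end
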